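(* The conjecture of Lieb-Solovej is asymptotically true, in the sense that $$\lim_{s\rightarrow \infty}\ \frac {\displaystyle\max_{F\in A^2 (\Pi^+),\, F\not \equiv 0} \frac {\int_{\Pi^+} |F(x+iy)|^{2s}y^{2s-2}\,dx\,dy}{\left (\int_{\Pi^+} |F(x+iy)|^2\,dx\,dy \right )^s}}{\displaystyle\frac {\pi^{1-s}}{(2s-1)2^{2s-2}}}=1.$$
   Context: $\Pi^+=\{x+iy\in\mathbb{C}: y>0\}$ is the upper half-plane. $A^2(\Pi^+)$ is the Bergman space of holomorphic functions $F$ on $\Pi^+$ with $\int_{\Pi^+}|F(x+iy)|^2\,dx\,dy<\infty$. The parameter $s$ ranges over real numbers $s\ge 1$. The conjecture of Lieb-Solovej, written as an extremum problem, says that for all $s>1$, $$\max_{F\in A^2 (\Pi^+),\, F\not \equiv 0} \frac {\int_{\Pi^+} |F(x+iy)|^{2s}y^{2s-2}\,dx\,dy}{\left (\int_{\Pi^+} |F(x+iy)|^2\,dx\,dy \right )^s}=\frac {\pi^{1-s}}{(2s-1)2^{2s-2}}.$$ *)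

theory Defs
  imports "HOL-Complex_Analysis.Complex_Analysis"
begin

definition upper_half_plane :: "complex set" where
  "upper_half_plane = {z. Im z > 0}"

text \<open>
  Elements are total functions on the complex numbers; their values outside the upper half-plane
  are arbitrary and play no role. The measure \<^term>\<open>lborel\<close> on the complex numbers is the area
  measure \<open>dx dy\<close>.
\<close>

definition bergman_space :: "(complex \<Rightarrow> complex) set" where
  "bergman_space = {F. F holomorphic_on upper_half_plane \<and>
     set_integrable lborel upper_half_plane (\<lambda>z. (cmod (F z))\<^sup>2)}"

definition bergman_nonzero :: "(complex \<Rightarrow> complex) set" where
  "bergman_nonzero = {F \<in> bergman_space. \<exists>z\<in>upper_half_plane. F z \<noteq> 0}"

text \<open>
  The numerator is an extended nonnegative integral, so that a divergent integral would count as
  infinity, not as the default value 0 of the Bochner integral. For \<open>F\<close> in \<^term>\<open>bergman_nonzero\<close>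
  the denominator is a positive real number.
\<close>

definition LS_quotient :: "real \<Rightarrow> (complex \<Rightarrow> complex) \<Rightarrow> ennreal" where
  "LS_quotient s F =
     (\<integral>\<^sup>+z\<in>upper_half_plane. ennreal (cmod (F z) powr (2 * s) * Im z powr (2 * s - 2)) \<partial>lborel)
     / ennreal ((LINT z:upper_half_plane|lborel. (cmod (F z))\<^sup>2) powr s)"

definition is_maximum :: "'a::linorder set \<Rightarrow> 'a \<Rightarrow> bool" where
  "is_maximum A m \<longleftrightarrow> m \<in> A \<and> (\<forall>a\<in>A. a \<le> m)"

end

theory Submission
  imports Defs "HOL-Real_Asymp.Real_Asymp"
begin

text \<open>
  For \<open>F\<close> in the Bergman space write \<open>u = |F| y\<close>. The numerator of the quotient is the integral of
  \<open>u\<close> to the power \<open>2 s\<close> against the hyperbolic area \<open>dx dy / y\<^sup>2\<close>, and the squared norm is the same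
  integral with exponent \<open>2\<close>. Both are invariant under conformal maps: under \<open>z \<mapsto> b + a z\<close>, which
  moves any point of the half-plane to \<open>\<i>\<close>, and under the Cayley transform, which carries
  \<open>F\<close> to a square-integrable holomorphic function \<open>f\<close> on the unit disc with \<open>2 u = |f| (1 - |w|\<^sup>2)\<close>.
  The mean value property of \<open>f\<^sup>2\<close> over the disc gives the sharp bound \<open>4 \<pi> u\<^sup>2 \<le> \<parallel>F\<parallel>\<^sup>2\<close>.

  The maximum exists. The group of affine maps makes the problem non-compact, but a maximizing sequence
  can be recentred so that \<open>u\<close> has its maximum at \<open>\<i>\<close>. The quotient is at most a power of this
  maximum, so the values at \<open>\<i>\<close> stay away from \<open>0\<close>, and Montel's theorem provides a limit \<open>g \<noteq> 0\<close> of a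
  subsequence. If \<open>g\<close> keeps the fraction \<open>m\<close> of the squared norm, the Brezis-Lieb splitting of norm
  and energy into the part of \<open>g\<close> and the part that escapes gives
  \<open>1 \<le> m\<^sup>s + (1 - m)\<^sup>s\<close>. Since \<open>s > 1\<close> and \<open>m > 0\<close>, this forces \<open>m = 1\<close>: nothing escapes, and \<open>g\<close>
  is a maximizer (\<open>energy_maximizer\<close>).

  The conjectured value is the quotient of the reproducing kernel at \<open>\<i>\<close>, which the Cayley transform
  turns into a constant; this bounds the maximum from below. For the upper bound let \<open>f\<close> come from a
  recentred maximizer with \<open>\<parallel>f\<parallel>\<^sup>2 = \<pi>\<close>. The lower bound and the bound by the maximum of \<open>u\<close> give
  \<open>(2 s - 1)\<^sup>-\<^sup>1 \<le> |f 0|\<^bsup>2 s - 2\<^esup>\<close>, so \<open>|f 0|\<close> tends to \<open>1\<close>. By orthogonality to constants the remainder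
  \<open>h = f - f 0\<close> has norm squared \<open>\<pi> (1 - |f 0|\<^sup>2)\<close>, and because \<open>|f| (1 - |w|\<^sup>2)\<close> is maximal at \<open>0\<close>, the
  derivative of \<open>f\<close> vanishes there. So \<open>h\<close> vanishes to second order and is small compared with \<open>|w|\<^sup>2\<close>,
  which yields \<open>|f| (1 - |w|\<^sup>2) \<le> 1 - (1 - \<kappa>) |w|\<^sup>2\<close> on the whole disc with \<open>\<kappa>\<close> tending to \<open>0\<close>.
  Near the origin this compares the energy with that of a constant; away from the origin it makes
  the remaining energy negligible (\<open>energy_le_of_concentrated\<close>).
\<close>

section \<open>Conformal change of variables\<close>

text \<open>
  Area measure is determined by its values on boxes, so Lebesgue measure on pairs of reals carries over
  to the complex plane. This gives access to the change of variables theorem on \<open>real^2\<close>.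
\<close>

lemma distr_vec2_complex:
  "distr lborel borel (\<lambda>v::real^2. Complex (v $ 1) (v $ 2)) = lborel"
proof (rule lborel_eqI[symmetric])
  fix l u :: complex
  assume le: "\<And>b. b \<in> Basis \<Longrightarrow> l \<bullet> b \<le> u \<bullet> b"
  have *: "(\<lambda>v::real^2. Complex (v $ 1) (v $ 2)) -` box l u
      = box (vector [Re l, Im l]) (vector [Re u, Im u])"
    by (rule set_eqI) (simp add: mem_box_cart(1) forall_2 in_box_complex_iff)
  have [measurable]: "(\<lambda>v::real^2. Complex (v $ 1) (v $ 2)) \<in> borel_measurable borel"
    unfolding Complex_eq
    by (intro borel_measurable_continuous_onI continuous_intros)
  have leR: "Re l \<le> Re u" "Im l \<le> Im u"
    using le[of 1] le[of \<i>] by (auto simp: Basis_complex_def)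
  have B: "(Basis :: (real^2) set) = {axis 1 1, axis 2 1}"
    by (auto simp: Basis_vec_def UNIV_2)
  have ne: "axis 1 (1::real) \<noteq> (axis 2 1 :: real^2)"
    by (simp add: axis_eq_axis)
  have "emeasure (distr lborel borel (\<lambda>v::real^2. Complex (v $ 1) (v $ 2))) (box l u)
      = emeasure lborel (box (vector [Re l, Im l]) (vector [Re u, Im u]) :: (real^2) set)"
    by (subst emeasure_distr) (auto simp: *)
  also have "\<dots> = ennreal ((Re u - Re l) * (Im u - Im l))"
    using leR by (subst emeasure_lborel_box) (auto simp: B ne inner_axis)
  finally show "emeasure (distr lborel borel (\<lambda>v::real^2. Complex (v $ 1) (v $ 2))) (box l u)
      = ennreal (\<Prod>b\<in>Basis. (u - l) \<bullet> b)"
    by (simp add: Basis_complex_def)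
qed simp

text \<open>
  The Jacobian determinant of a holomorphic map is \<open>|\<phi>'|\<^sup>2\<close>. The set is prescribed in the image, so that
  its measurability is a hypothesis on \<open>B\<close>; both sides may be infinite.
\<close>

lemma emeasure_conformal_image:
  assumes S: "open S" and hol: "\<phi> holomorphic_on S" and inj: "inj_on \<phi> S"
    and B: "B \<in> sets borel" "B \<subseteq> \<phi> ` S" and A: "A = S \<inter> \<phi> -` B" "A \<in> sets borel"
  shows "emeasure lborel B = (\<integral>\<^sup>+z\<in>A. ennreal ((cmod (deriv \<phi> z))\<^sup>2) \<partial>lborel)"
proof -
  define T :: "real^2 \<Rightarrow> complex" where "T v = Complex (v $ 1) (v $ 2)" for v
  define T' :: "complex \<Rightarrow> real^2" where "T' z = vector [Re z, Im z]" for z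
  have T'T [simp]: "T' (T v) = v" for v
    by (simp add: T_def T'_def vec_eq_iff forall_2)
  have TT' [simp]: "T (T' z) = z" for z
    by (simp add: T_def T'_def)
  have [measurable]: "T \<in> borel_measurable borel"
    unfolding T_def Complex_eq by (intro borel_measurable_continuous_onI continuous_intros)
  have distrT: "distr lborel borel T = lborel"
    using distr_vec2_complex by (simp add: T_def[abs_def])
  have linT: "bounded_linear T"
    unfolding T_def by (rule linear_conv_bounded_linear[THEN iffD1], rule linearI)
      (auto simp: complex_eq_iff)
  have linT': "bounded_linear T'"
    unfolding T'_def by (rule linear_conv_bounded_linear[THEN iffD1], rule linearI)
      (auto simp: vec_eq_iff forall_2)
  define A' where "A' = T -` A"
  have A'_borel [measurable]: "A' \<in> sets borel"
    using measurable_sets[of T borel borel A] A by (simp add: A'_def)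
  (* phi read in real coordinates *)
  define g where "g v = T' (\<phi> (T v))" for v
  define g' where "g' v = (\<lambda>h. T' (deriv \<phi> (T v) * T h))" for v
  have der: "(g has_derivative g' v) (at v within A')" if "v \<in> A'" for v
  proof -
    have "T v \<in> S" using that A by (auto simp: A'_def)
    then have "(\<phi> has_field_derivative deriv \<phi> (T v)) (at (T v))"
      using hol S holomorphic_derivI by blast
    then have "(\<phi> has_derivative (\<lambda>h. deriv \<phi> (T v) * h)) (at (T v))"
      by (simp add: has_field_derivative_def)
    then have "(\<phi> has_derivative (\<lambda>h. deriv \<phi> (T v) * h)) (at (T v) within T ` A')"
      using has_derivative_at_withinI by blast
    from has_derivative_in_compose[OF bounded_linear_imp_has_derivative[OF linT] this]
    have "((\<lambda>v. \<phi> (T v)) has_derivative (\<lambda>h. deriv \<phi> (T v) * T h)) (at v within A')" .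
    from bounded_linear.has_derivative[OF linT' this]
    show ?thesis unfolding g_def g'_def .
  qed
  have injg: "inj_on g A'"
  proof (rule inj_onI)
    fix v w assume vw: "v \<in> A'" "w \<in> A'" "g v = g w"
    then have "\<phi> (T v) = \<phi> (T w)" unfolding g_def by (metis TT')
    moreover have "T v \<in> S" "T w \<in> S" using vw A by (auto simp: A'_def)
    ultimately have "T v = T w" using inj by (auto dest: inj_onD)
    then show "v = w" by (metis T'T)
  qed
  have det: "\<bar>det (matrix (g' v))\<bar> = (cmod (deriv \<phi> (T v)))\<^sup>2" for v
    unfolding matrix_def g'_def T_def T'_def
    by (simp add: det_2 axis_def cmod_power2) (simp add: power2_eq_square)
  have imA: "\<phi> ` A = B" using A B by blast
  have img: "g ` A' = T -` B"
  proof
    show "g ` A' \<subseteq> T -` B" using imA by (auto simp: g_def A'_def)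
    show "T -` B \<subseteq> g ` A'"
    proof
      fix v assume "v \<in> T -` B"
      then obtain a where a: "a \<in> A" "\<phi> a = T v" using imA by (metis imageE vimageE)
      then have "g (T' a) = v" "T' a \<in> A'" by (auto simp: g_def A'_def)
      then show "v \<in> g ` A'" by blast
    qed
  qed
  have TB [measurable]: "T -` B \<in> sets borel"
    using measurable_sets[of T borel borel B] B by simp
  have iff: "(T -` B \<in> lmeasurable \<and> measure lebesgue (T -` B) = m) \<longleftrightarrow>
      ((\<lambda>x. (cmod (deriv \<phi> (T x)))\<^sup>2) has_integral m) A'" for m
    using has_measure_differentiable_image[of A' g g' m, OF _ der injg]
    unfolding det img by auto
  define f where "f v = indicator A' v * (cmod (deriv \<phi> (T v)))\<^sup>2" for v
  have f_if: "f = (\<lambda>x. if x \<in> A' then (cmod (deriv \<phi> (T x)))\<^sup>2 else 0)"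
    by (auto simp: f_def fun_eq_iff)
  have mA [measurable]: "A \<in> sets borel" by (rule A)
  have "continuous_on S (deriv \<phi>)"
    by (rule holomorphic_on_imp_continuous_on[OF holomorphic_deriv[OF hol S]])
  then have "continuous_on A (deriv \<phi>)" using A continuous_on_subset by blast
  then have [measurable]: "(\<lambda>z. indicator A z *\<^sub>R deriv \<phi> z) \<in> borel_measurable borel"
    by (intro borel_measurable_continuous_on_indicator) auto
  have f_alt: "f v = (cmod (indicator A (T v) *\<^sub>R deriv \<phi> (T v)))\<^sup>2" for v
    by (auto simp: f_def A'_def indicator_def)
  have [measurable]: "f \<in> borel_measurable borel"
    unfolding f_alt[abs_def] by measurable
  have "(\<integral>\<^sup>+z\<in>A. ennreal ((cmod (deriv \<phi> z))\<^sup>2) \<partial>lborel)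
      = (\<integral>\<^sup>+z. ennreal ((cmod (indicator A z *\<^sub>R deriv \<phi> z))\<^sup>2) \<partial>lborel)"
    by (intro nn_integral_cong) (auto simp: indicator_def)
  also have "\<dots> = (\<integral>\<^sup>+z. ennreal ((cmod (indicator A z *\<^sub>R deriv \<phi> z))\<^sup>2) \<partial>distr lborel borel T)"
    by (simp add: distrT)
  also have "\<dots> = (\<integral>\<^sup>+v. ennreal (f v) \<partial>lborel)"
    unfolding f_alt by (rule nn_integral_distr) measurable
  finally have I: "(\<integral>\<^sup>+z\<in>A. ennreal ((cmod (deriv \<phi> z))\<^sup>2) \<partial>lborel) = (\<integral>\<^sup>+v. ennreal (f v) \<partial>lborel)" .
  have "emeasure lborel B = emeasure (distr lborel borel T) B" by (simp add: distrT)
  also have "\<dots> = emeasure lborel (T -` B)" using B by (subst emeasure_distr) auto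
  finally have E: "emeasure lborel B = emeasure lborel (T -` B)" .
  have "emeasure lborel (T -` B) = (\<integral>\<^sup>+v. ennreal (f v) \<partial>lborel)"
  (* The two sides are finite simultaneously, and then equal. *)
  proof (cases "(\<integral>\<^sup>+v. ennreal (f v) \<partial>lborel)")
    case (real r)
    then have "(f has_integral r) UNIV"
      by (intro nn_integral_has_integral) (auto simp: f_def)
    then have "((\<lambda>x. (cmod (deriv \<phi> (T x)))\<^sup>2) has_integral r) A'"
      unfolding f_if has_integral_restrict_UNIV .
    then have "T -` B \<in> lmeasurable" "measure lebesgue (T -` B) = r" using iff by auto
    then have "emeasure lebesgue (T -` B) = ennreal r"
      using emeasure_eq_measure2[of "T -` B" lebesgue] by simp
    then show ?thesis
      using real TB by (simp add: emeasure_completion main_part_sets)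
  next
    case top
    have "T -` B \<notin> lmeasurable"
    proof
      assume "T -` B \<in> lmeasurable"
      then have *: "((\<lambda>x. (cmod (deriv \<phi> (T x)))\<^sup>2) has_integral measure lebesgue (T -` B)) A'"
        using iff by blast
      have "(\<integral>\<^sup>+v. ennreal (f v) \<partial>lborel) = ennreal (measure lebesgue (T -` B))"
        using nn_integral_has_integral_lebesgue[OF _ *] by (simp add: f_def)
      then show False using top by simp
    qed
    then have "emeasure lborel (T -` B) = top"
      using TB less_top[of "emeasure lborel (T -` B)"]
      by (auto simp: fmeasurable_def emeasure_completion main_part_sets)
    then show ?thesis using top by simp
  qed
  then show ?thesis using E I by simp
qed

text \<open>
  By the preceding lemma, the image under \<open>\<phi>\<close> of the measure with density \<open>|\<phi>'|\<^sup>2\<close> on \<open>S\<close> is area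
  measure on \<open>\<phi> ` S\<close>.
\<close>

lemma nn_integral_conformal_image:
  fixes h :: "complex \<Rightarrow> ennreal"
  assumes S: "open S" and hol: "\<phi> holomorphic_on S" and inj: "inj_on \<phi> S"
    and h: "(\<lambda>w. h w * indicator (\<phi> ` S) w) \<in> borel_measurable borel"
  shows "(\<integral>\<^sup>+w\<in>\<phi> ` S. h w \<partial>lborel)
       = (\<integral>\<^sup>+z\<in>S. h (\<phi> z) * ennreal ((cmod (deriv \<phi> z))\<^sup>2) \<partial>lborel)"
proof -
  define p where "p z = ennreal ((cmod (indicator S z *\<^sub>R deriv \<phi> z))\<^sup>2)" for z
  define \<psi> where "\<psi> z = (if z \<in> S then \<phi> z else 0)" for z
  have [measurable]: "S \<in> sets borel" using S by simp
  have contd: "continuous_on S (deriv \<phi>)"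
    by (rule holomorphic_on_imp_continuous_on[OF holomorphic_deriv[OF hol S]])
  have cont: "continuous_on S \<phi>"
    by (rule holomorphic_on_imp_continuous_on[OF hol])
  have [measurable]: "(\<lambda>z. indicator S z *\<^sub>R deriv \<phi> z) \<in> borel_measurable borel"
    using contd by (intro borel_measurable_continuous_on_indicator) auto
  have [measurable]: "p \<in> borel_measurable borel"
    unfolding p_def by measurable
  have [measurable]: "\<psi> \<in> borel_measurable borel"
    unfolding \<psi>_def using cont by (intro borel_measurable_continuous_on_if) auto
  have im [measurable]: "\<phi> ` S \<in> sets borel"
    using open_mapping_thm3[OF hol S inj] by simp
  have eq: "distr (density lborel p) borel \<psi> = density lborel (indicator (\<phi> ` S))"
  proof (rule measure_eqI)
    fix B assume "B \<in> sets (distr (density lborel p) borel \<psi>)"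
    then have B [measurable]: "B \<in> sets borel" by simp
    define A where "A = S \<inter> \<phi> -` (B \<inter> \<phi> ` S)"
    have A_alt: "A = S \<inter> (\<psi> -` B \<inter> space borel)"
      by (auto simp: A_def \<psi>_def)
    have A_borel: "A \<in> sets borel" unfolding A_alt by measurable
    have "emeasure (distr (density lborel p) borel \<psi>) B
        = (\<integral>\<^sup>+z. p z * indicator (\<psi> -` B) z \<partial>lborel)"
      using measurable_sets[of \<psi> borel borel B]
      by (subst emeasure_distr, simp, simp, subst emeasure_density) simp_all
    also have "\<dots> = (\<integral>\<^sup>+z\<in>A. ennreal ((cmod (deriv \<phi> z))\<^sup>2) \<partial>lborel)"
      by (intro nn_integral_cong) (simp add: p_def A_def \<psi>_def split: split_indicator)
    also have "\<dots> = emeasure lborel (B \<inter> \<phi> ` S)"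
      by (rule emeasure_conformal_image[OF S hol inj, symmetric])
         (simp, simp, rule A_def, rule A_borel)
    also have "\<dots> = emeasure (density lborel (indicator (\<phi> ` S))) B"
      by (subst emeasure_density, simp, simp, subst nn_integral_indicator[symmetric], simp,
          intro nn_integral_cong) (simp split: split_indicator)
    finally show "emeasure (distr (density lborel p) borel \<psi>) B
        = emeasure (density lborel (indicator (\<phi> ` S))) B" .
  qed simp
  define k where "k w = h w * indicator (\<phi> ` S) w" for w
  have [measurable]: "k \<in> borel_measurable borel" using h by (simp add: k_def[abs_def])
  have "(\<integral>\<^sup>+w\<in>\<phi> ` S. h w \<partial>lborel) = (\<integral>\<^sup>+w. k w \<partial>density lborel (indicator (\<phi> ` S)))"
    by (subst nn_integral_density, simp, simp, intro nn_integral_cong)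
       (simp add: k_def split: split_indicator)
  also have "\<dots> = (\<integral>\<^sup>+z. p z * k (\<psi> z) \<partial>lborel)"
    unfolding eq[symmetric]
    by (subst nn_integral_distr, simp, simp, subst nn_integral_density) simp_all
  also have "\<dots> = (\<integral>\<^sup>+z\<in>S. h (\<phi> z) * ennreal ((cmod (deriv \<phi> z))\<^sup>2) \<partial>lborel)"
    by (intro nn_integral_cong) (auto simp: p_def k_def \<psi>_def indicator_def mult.commute)
  finally show ?thesis .
qed

section \<open>Mean values over discs\<close>

lemma distr_rotation_lborel:
  assumes c: "cmod c = 1"
  shows "distr lborel borel (\<lambda>z. c * z) = lborel"
proof (rule measure_eqI)
  fix B assume "B \<in> sets (distr lborel borel (\<lambda>z. c * z))"
  then have B [measurable]: "B \<in> sets borel" by simp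
  have c0: "c \<noteq> 0" using c by auto
  have surj: "B \<subseteq> range (\<lambda>z. c * z)"
  proof
    fix b show "b \<in> range (\<lambda>z. c * z)"
      using c0 by (intro image_eqI[of _ _ "b / c"]) auto
  qed
  have [measurable]: "(\<lambda>z. c * z) -` B \<in> sets borel"
    using measurable_sets[of "\<lambda>z. c * z" borel borel B] by simp
  have "emeasure lborel B
      = (\<integral>\<^sup>+z\<in>(\<lambda>z. c * z) -` B. ennreal ((cmod (deriv (\<lambda>z. c * z) z))\<^sup>2) \<partial>lborel)"
    using surj c0 by (intro emeasure_conformal_image[of UNIV])
      (auto intro!: holomorphic_intros inj_onI)
  also have "\<dots> = emeasure lborel ((\<lambda>z. c * z) -` B)"
    using c by simp
  also have "\<dots> = emeasure (distr lborel borel (\<lambda>z. c * z)) B"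
    by (subst emeasure_distr) auto
  finally show "emeasure (distr lborel borel (\<lambda>z. c * z)) B = emeasure lborel B" by simp
qed simp

text \<open>
  Cauchy's integral formula at the centre. The parametrization starts at the arbitrary point \<open>c + z\<close> of
  the circle, the form in which averaging over rotations produces it.
\<close>

lemma circle_mean_value:
  assumes hol: "g holomorphic_on ball c R" and z: "cmod z < R"
  shows "(LBINT t:{0..1}. g (c + exp (2 * of_real pi * \<i> * of_real t) * z)) = g c"
proof -
  define k where "k w = g (c + w * z)" for w
  have cont: "continuous_on (ball c R) g"
    using hol holomorphic_on_imp_continuous_on by blast
  have sub: "(\<lambda>w. c + w * z) ` cball 0 1 \<subseteq> ball c R"
  proof
    fix x assume "x \<in> (\<lambda>w. c + w * z) ` cball 0 1"
    then obtain w where w: "cmod w \<le> 1" "x = c + w * z" by auto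
    have "cmod (w * z) \<le> cmod z" using w(1) by (simp add: norm_mult mult_left_le_one_le)
    then show "x \<in> ball c R" using z w by (auto simp: dist_norm)
  qed
  have "continuous_on (cball 0 1) k"
    unfolding k_def
    by (rule continuous_on_compose2[OF cont _ sub]) (intro continuous_intros)
  moreover have "k holomorphic_on ball 0 1"
  proof -
    have "(g \<circ> (\<lambda>w. c + w * z)) holomorphic_on ball 0 1"
    proof (rule holomorphic_on_compose_gen[OF _ hol])
      show "(\<lambda>w. c + w * z) holomorphic_on ball 0 1" by (intro holomorphic_intros)
      show "(\<lambda>w. c + w * z) ` ball 0 1 \<subseteq> ball c R"
        using sub ball_subset_cball by (meson image_mono order_trans)
    qed
    then show ?thesis by (simp add: k_def[abs_def] o_def)
  qed
  ultimately have "((\<lambda>u. k u / (u - 0)) has_contour_integral 2 * of_real pi * \<i> * k 0) (circlepath 0 1)"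
    by (intro Cauchy_integral_circlepath) auto
  then have "((\<lambda>t. k (circlepath 0 1 t) / circlepath 0 1 t *
        vector_derivative (circlepath 0 1) (at t within {0..1}))
      has_integral 2 * of_real pi * \<i> * k 0) {0..1}"
    by (simp add: has_contour_integral_def)
  then have "((\<lambda>t. (2 * of_real pi * \<i>) * k (exp (2 * of_real pi * \<i> * of_real t)))
      has_integral 2 * of_real pi * \<i> * k 0) {0..1}"
  proof (rule has_integral_eq[rotated])
    fix t :: real assume t: "t \<in> {0..1}"
    then have "vector_derivative (circlepath 0 1) (at t within {0..1})
        = 2 * of_real pi * \<i> * exp (2 * of_real pi * \<i> * of_real t)"
      using vector_derivative_circlepath01[of t 0 1] by simp
    then show "k (circlepath 0 1 t) / circlepath 0 1 t *
        vector_derivative (circlepath 0 1) (at t within {0..1})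
        = (2 * of_real pi * \<i>) * k (exp (2 * of_real pi * \<i> * of_real t))"
      by (simp add: circlepath)
  qed
  from has_integral_mult_right[OF this, of "inverse (2 * of_real pi * \<i>)"]
  have I: "((\<lambda>t. k (exp (2 * of_real pi * \<i> * of_real t))) has_integral k 0) {0..1}"
    by (simp add: field_simps)
  have "continuous_on {0..1} (\<lambda>t::real. k (exp (2 * of_real pi * \<i> * of_real t)))"
    by (rule continuous_on_compose2[OF \<open>continuous_on (cball 0 1) k\<close>])
       (auto intro!: continuous_intros)
  then have "set_integrable lborel {0..1} (\<lambda>t::real. k (exp (2 * of_real pi * \<i> * of_real t)))"
    by (rule borel_integrable_atLeastAtMost')
  from set_borel_integral_eq_integral(2)[OF this] I
  have "(LBINT t:{0..1}. k (exp (2 * of_real pi * \<i> * of_real t))) = k 0"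
    by (simp add: integral_unique)
  then show ?thesis by (simp add: k_def)
qed

text \<open>
  Rotations about \<open>c\<close> preserve area, so the integral of \<open>g\<close> over the disc equals its average over all
  rotated copies of \<open>g\<close>. Exchanging the two integrations averages \<open>g\<close> first over circles, which gives the
  constant \<open>g c\<close>.
\<close>

lemma disc_mean_value:
  assumes hol: "g holomorphic_on ball c R" and R: "R > 0"
    and int: "set_integrable lborel (ball c R) g"
  shows "(LINT z:ball c R|lborel. g z) = of_real (pi * R\<^sup>2) * g c"
proof -
  define e where "e t = exp (2 * of_real pi * \<i> * of_real t)" for t :: real
  have norm_e: "cmod (e t) = 1" for t by (simp add: e_def norm_exp_eq_Re)
  define G where "G z = indicator (ball c R) z *\<^sub>R g z" for z
  have G: "integrable lborel G"
    using int by (simp add: set_integrable_def G_def[abs_def])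
  have [measurable]: "G \<in> borel_measurable borel"
    using borel_measurable_integrable[OF G] by simp
  have [measurable]: "e \<in> borel_measurable borel"
    unfolding e_def by (intro borel_measurable_continuous_onI continuous_intros)
  have rot_meas: "(\<lambda>z. c + e t * z) \<in> borel_measurable borel" for t by measurable
  have D: "distr lborel borel (\<lambda>z. c + e t * z) = lborel" for t
  proof -
    have "distr lborel borel (\<lambda>z. c + e t * z)
        = distr (distr lborel borel (\<lambda>z. e t * z)) borel (\<lambda>z. c + z)"
      by (subst distr_distr) (auto simp: o_def)
    then show ?thesis by (simp add: distr_rotation_lborel norm_e lborel_distr_plus)
  qed
  have Gt: "integrable lborel (\<lambda>z. G (c + e t * z))" for t
    by (rule integrable_distr[of _ _ borel]) (use rot_meas in \<open>simp_all add: D G\<close>)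
  have IGt: "(LINT z|lborel. G (c + e t * z)) = (LINT z|lborel. G z)" for t
    using integral_distr[of "\<lambda>z. c + e t * z" lborel borel G] D[of t] by simp
  have INt: "(LINT z|lborel. cmod (G (c + e t * z))) = (LINT z|lborel. cmod (G z))" for t
    using integral_distr[of "\<lambda>z. c + e t * z" lborel borel "\<lambda>z. cmod (G z)"] D[of t] by simp
  define H where "H t z = indicator {0..1::real} t *\<^sub>R G (c + e t * z)" for t z
  have "integrable (lborel \<Otimes>\<^sub>M lborel) (case_prod H)"
  proof (rule lborel_pair.Fubini_integrable)
    show "case_prod H \<in> borel_measurable (lborel \<Otimes>\<^sub>M lborel)"
      unfolding H_def split_beta' by measurable
    have "(\<lambda>t. LINT z|lborel. cmod (H t z))
        = (\<lambda>t. indicator {0..1} t *\<^sub>R (LINT z|lborel. cmod (G z)))"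
      by (auto simp: H_def INt fun_eq_iff indicator_def)
    then show "integrable lborel (\<lambda>t. LINT z|lborel. cmod (case_prod H (t, z)))"
      by (simp add: integrable_indicator_iff)
    show "AE t in lborel. integrable lborel (\<lambda>z. case_prod H (t, z))"
      by (simp add: H_def Gt)
  qed
  from lborel_pair.Fubini_integral[OF this]
  have F: "(LINT z|lborel. LINT t|lborel. H t z) = (LINT t|lborel. LINT z|lborel. H t z)" .
  have L: "(LINT t|lborel. LINT z|lborel. H t z) = (LINT z|lborel. G z)"
  proof -
    have "(LINT t|lborel. LINT z|lborel. H t z) = (LINT t|lborel. indicator {0..1::real} t *\<^sub>R (LINT z|lborel. G z))"
      by (simp add: H_def IGt)
    also have "\<dots> = (LINT t|lborel. indicator {0..1::real} t) *\<^sub>R (LINT z|lborel. G z)"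
      by (rule integral_scaleR_left) simp
    finally show ?thesis by simp
  qed
  have "(LINT t|lborel. H t z) = indicator (ball 0 R) z *\<^sub>R g c" for z
  proof (cases "cmod z < R")
    case True
    have "H t z = indicator {0..1} t *\<^sub>R g (c + e t * z)" for t
      using True by (auto simp: H_def G_def dist_norm norm_mult norm_e)
    then show ?thesis
      using circle_mean_value[OF hol True] True by (simp add: set_lebesgue_integral_def e_def)
  next
    case False
    have "H t z = 0" for t
      using False by (auto simp: H_def G_def dist_norm norm_mult norm_e)
    then show ?thesis using False by simp
  qed
  then have "(LINT z|lborel. LINT t|lborel. H t z) = (LINT z|lborel. indicator (ball 0 R) (z :: complex) *\<^sub>R g c)"
    by simp
  also have "\<dots> = of_real (pi * R\<^sup>2) * g c"
    using R content_ball[of R "0::complex"]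
    by (simp add: integral_scaleR_left unit_ball_vol_2 scaleR_conv_of_real)
  finally show ?thesis
    using F L by (simp add: set_lebesgue_integral_def G_def)
qed

text \<open>
  The mean value property of \<open>g\<^sup>2\<close>, followed by the triangle inequality for integrals.
\<close>

lemma norm_square_le_disc_mean:
  assumes hol: "g holomorphic_on ball c R" and R: "R > 0"
    and int: "set_integrable lborel (ball c R) (\<lambda>z. (cmod (g z))\<^sup>2)"
  shows "pi * R\<^sup>2 * (cmod (g c))\<^sup>2 \<le> (LINT z:ball c R|lborel. (cmod (g z))\<^sup>2)"
proof -
  have hol2: "(\<lambda>z. (g z)\<^sup>2) holomorphic_on ball c R"
    using hol by (intro holomorphic_intros)
  have meas: "(\<lambda>z. indicator (ball c R) z *\<^sub>R (g z)\<^sup>2) \<in> borel_measurable borel"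
    using holomorphic_on_imp_continuous_on[OF hol2]
    by (intro borel_measurable_continuous_on_indicator) auto
  have int2: "set_integrable lborel (ball c R) (\<lambda>z. (g z)\<^sup>2)"
    unfolding set_integrable_def
    by (rule Bochner_Integration.integrable_bound[OF int[unfolded set_integrable_def]])
       (use meas in \<open>auto simp: norm_power\<close>)
  have "pi * R\<^sup>2 * (cmod (g c))\<^sup>2 = cmod (of_real (pi * R\<^sup>2) * (g c)\<^sup>2)"
    by (simp add: norm_mult norm_power)
  also have "\<dots> = cmod (LINT z:ball c R|lborel. (g z)\<^sup>2)"
    using disc_mean_value[OF hol2 R int2] by simp
  also have "\<dots> \<le> (LINT z:ball c R|lborel. cmod ((g z)\<^sup>2))"
    unfolding set_lebesgue_integral_def
    by (rule order.trans[OF integral_norm_bound]) simp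
  finally show ?thesis by (simp add: norm_power)
qed

section \<open>Energies and their conformal invariance\<close>

text \<open>
  The integral of \<open>(|F| y)\<^sup>p\<close> against hyperbolic area: for \<open>p = 2\<close> the squared Bergman norm, for
  \<open>p = 2 s\<close> the numerator of the Lieb-Solovej quotient.
\<close>

definition nn_energy :: "real \<Rightarrow> (complex \<Rightarrow> complex) \<Rightarrow> ennreal" where
  "nn_energy p F =
     (\<integral>\<^sup>+z\<in>upper_half_plane. ennreal (cmod (F z) powr p * Im z powr (p - 2)) \<partial>lborel)"

definition energy :: "real \<Rightarrow> (complex \<Rightarrow> complex) \<Rightarrow> real" where
  "energy p F = (LINT z:upper_half_plane|lborel. cmod (F z) powr p * Im z powr (p - 2))"

lemma open_upper_half_plane [simp]: "open upper_half_plane"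
  unfolding upper_half_plane_def by (rule open_halfspace_Im_gt)

lemma energy_density_measurable:
  assumes "F holomorphic_on upper_half_plane"
  shows "(\<lambda>z. indicator upper_half_plane z *\<^sub>R (cmod (F z) powr p * Im z powr (p - 2)))
    \<in> borel_measurable borel"
proof -
  have cont: "continuous_on upper_half_plane F"
    using assms by (rule holomorphic_on_imp_continuous_on)
  have [measurable]: "(\<lambda>z. indicator upper_half_plane z *\<^sub>R F z) \<in> borel_measurable borel"
    using cont by (intro borel_measurable_continuous_on_indicator) auto
  have [measurable]: "Im \<in> borel_measurable borel"
    by (intro borel_measurable_continuous_onI continuous_intros)
  have "(\<lambda>z. indicator upper_half_plane z *\<^sub>R (cmod (F z) powr p * Im z powr (p - 2)))
      = (\<lambda>z. indicator upper_half_plane z *\<^sub>R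
          (cmod (indicator upper_half_plane z *\<^sub>R F z) powr p * Im z powr (p - 2)))"
    by (auto simp: indicator_def fun_eq_iff)
  also have "\<dots> \<in> borel_measurable borel" by measurable
  finally show ?thesis .
qed

lemma nn_energy_alt:
  "nn_energy p F = (\<integral>\<^sup>+z. ennreal (indicator upper_half_plane z *\<^sub>R
     (cmod (F z) powr p * Im z powr (p - 2))) \<partial>lborel)"
  unfolding nn_energy_def by (intro nn_integral_cong) (auto simp: indicator_def)

lemma set_integrable_energy_iff:
  assumes "F holomorphic_on upper_half_plane"
  shows "set_integrable lborel upper_half_plane (\<lambda>z. cmod (F z) powr p * Im z powr (p - 2))
     \<longleftrightarrow> nn_energy p F < \<infinity>"
  unfolding set_integrable_def nn_energy_alt
  by (subst integrable_iff_bounded) (use energy_density_measurable[OF assms] in \<open>auto simp: \<close>)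

lemma bergman_space_iff:
  "F \<in> bergman_space \<longleftrightarrow> F holomorphic_on upper_half_plane \<and> nn_energy 2 F < \<infinity>"
proof -
  have "set_integrable lborel upper_half_plane (\<lambda>z. (cmod (F z))\<^sup>2)
     \<longleftrightarrow> set_integrable lborel upper_half_plane (\<lambda>z. cmod (F z) powr 2 * Im z powr (2 - 2))"
    unfolding set_integrable_def
    by (intro Bochner_Integration.integrable_cong)
       (auto simp: upper_half_plane_def indicator_def)
  then show ?thesis
    using set_integrable_energy_iff[of F 2] by (auto simp: bergman_space_def)
qed

lemma energy_two: "energy 2 F = (LINT z:upper_half_plane|lborel. (cmod (F z))\<^sup>2)"
  unfolding energy_def set_lebesgue_integral_def
  by (intro Bochner_Integration.integral_cong) (auto simp: upper_half_plane_def indicator_def)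

lemma energy_nonneg: "0 \<le> energy p F"
  unfolding energy_def set_lebesgue_integral_def
  by (intro Bochner_Integration.integral_nonneg) (auto simp: indicator_def)

lemma nn_energy_eq_energy:
  assumes "F holomorphic_on upper_half_plane" "nn_energy p F < \<infinity>"
  shows "nn_energy p F = ennreal (energy p F)"
  using set_integrable_energy_iff[OF assms(1), of p] assms(2)
  unfolding nn_energy_alt energy_def set_lebesgue_integral_def set_integrable_def
  by (intro nn_integral_eq_integral) (auto simp: indicator_def)

text \<open>
  The exponents of \<open>|F|\<close> and of \<open>y\<close> differ by \<open>2\<close>, exactly what the Jacobian \<open>|\<phi>'|\<^sup>2\<close> absorbs when \<open>F\<close> is
  transported by \<open>F \<mapsto> (F \<circ> \<phi>) \<phi>'\<close>. The function \<open>\<rho>\<close> replaces the height \<open>y\<close> on \<open>S\<close>.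
  Both the affine maps and the Cayley transform are instances.
\<close>

lemma nn_energy_conformal:
  assumes F: "F holomorphic_on upper_half_plane"
    and S: "open S" and hol: "\<phi> holomorphic_on S" and inj: "inj_on \<phi> S"
    and img: "\<phi> ` S = upper_half_plane"
    and \<rho>: "\<And>z. z \<in> S \<Longrightarrow> \<rho> z > 0 \<and> Im (\<phi> z) = \<rho> z * cmod (deriv \<phi> z)"
  shows "nn_energy p F
    = (\<integral>\<^sup>+z\<in>S. ennreal (cmod (F (\<phi> z) * deriv \<phi> z) powr p * \<rho> z powr (p - 2)) \<partial>lborel)"
proof -
  have "nn_energy p F = (\<integral>\<^sup>+w\<in>\<phi> ` S. ennreal (cmod (F w) powr p * Im w powr (p - 2)) \<partial>lborel)"
    by (simp add: nn_energy_def img)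
  also have "\<dots> = (\<integral>\<^sup>+z\<in>S. ennreal (cmod (F (\<phi> z)) powr p * Im (\<phi> z) powr (p - 2))
        * ennreal ((cmod (deriv \<phi> z))\<^sup>2) \<partial>lborel)"
  proof (rule nn_integral_conformal_image[OF S hol inj])
    have "(\<lambda>w. ennreal (indicator upper_half_plane w *\<^sub>R (cmod (F w) powr p * Im w powr (p - 2))))
        \<in> borel_measurable borel"
      using energy_density_measurable[OF F, of p] by simp
    also have "(\<lambda>w. ennreal (indicator upper_half_plane w *\<^sub>R (cmod (F w) powr p * Im w powr (p - 2))))
      = (\<lambda>w. ennreal (cmod (F w) powr p * Im w powr (p - 2)) * indicator (\<phi> ` S) w)"
      by (auto simp: fun_eq_iff indicator_def img)
    finally show "(\<lambda>w. ennreal (cmod (F w) powr p * Im w powr (p - 2)) * indicator (\<phi> ` S) w)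
        \<in> borel_measurable borel" .
  qed
  also have "\<dots> = (\<integral>\<^sup>+z\<in>S. ennreal (cmod (F (\<phi> z) * deriv \<phi> z) powr p * \<rho> z powr (p - 2)) \<partial>lborel)"
  proof (intro nn_integral_cong, simp split: split_indicator, intro impI)
    fix z assume z: "z \<in> S"
    have "Im (\<phi> z) > 0" using z img by (auto simp: upper_half_plane_def)
    then have d: "cmod (deriv \<phi> z) > 0" using \<rho>[OF z] by (cases "deriv \<phi> z = 0") auto
    have "Im (\<phi> z) powr (p - 2) * (cmod (deriv \<phi> z))\<^sup>2
        = \<rho> z powr (p - 2) * (cmod (deriv \<phi> z) powr (p - 2) * cmod (deriv \<phi> z) powr 2)"
      using \<rho>[OF z] d by (simp add: powr_mult)
    also have "\<dots> = \<rho> z powr (p - 2) * cmod (deriv \<phi> z) powr p"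
      by (subst powr_add[symmetric]) simp
    finally have "cmod (F (\<phi> z)) powr p * Im (\<phi> z) powr (p - 2) * (cmod (deriv \<phi> z))\<^sup>2
        = cmod (F (\<phi> z) * deriv \<phi> z) powr p * \<rho> z powr (p - 2)"
      by (simp add: norm_mult powr_mult mult.assoc mult.left_commute mult.commute)
    then show "ennreal (cmod (F (\<phi> z)) powr p * Im (\<phi> z) powr (p - 2)) * ennreal ((cmod (deriv \<phi> z))\<^sup>2)
        = ennreal (cmod (F (\<phi> z) * deriv \<phi> z) powr p * \<rho> z powr (p - 2))"
      by (subst ennreal_mult[symmetric]) simp_all
  qed
  finally show ?thesis .
qed

text \<open>
  The transport of \<open>F\<close> by the affine automorphism of the half-plane that sends \<open>\<i>\<close> to \<open>w\<close>.
\<close>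

definition recentre :: "complex \<Rightarrow> (complex \<Rightarrow> complex) \<Rightarrow> complex \<Rightarrow> complex" where
  "recentre w F = (\<lambda>z. F (of_real (Re w) + of_real (Im w) * z) * of_real (Im w))"

lemma recentre_in_half_plane:
  "Im w > 0 \<Longrightarrow> z \<in> upper_half_plane \<Longrightarrow> of_real (Re w) + of_real (Im w) * z \<in> upper_half_plane"
  by (simp add: upper_half_plane_def)

lemma recentre_holomorphic:
  assumes "F holomorphic_on upper_half_plane" "Im w > 0"
  shows "recentre w F holomorphic_on upper_half_plane"
proof -
  have "(F \<circ> (\<lambda>z. of_real (Re w) + of_real (Im w) * z)) holomorphic_on upper_half_plane"
    by (rule holomorphic_on_compose_gen[OF _ assms(1)])
       (use assms(2) in \<open>auto intro!: holomorphic_intros simp: recentre_in_half_plane\<close>)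
  then have "(\<lambda>z. (F \<circ> (\<lambda>z. of_real (Re w) + of_real (Im w) * z)) z * of_real (Im w))
      holomorphic_on upper_half_plane"
    by (intro holomorphic_intros)
  then show ?thesis by (simp add: recentre_def o_def)
qed

lemma nn_energy_recentre:
  assumes F: "F holomorphic_on upper_half_plane" and w: "Im w > 0"
  shows "nn_energy p (recentre w F) = nn_energy p F"
proof -
  define \<phi> where "\<phi> z = of_real (Re w) + of_real (Im w) * z" for z :: complex
  have d: "deriv \<phi> z = of_real (Im w)" for z
    unfolding \<phi>_def by (rule DERIV_imp_deriv) (auto intro!: derivative_eq_intros)
  have "nn_energy p F = (\<integral>\<^sup>+z\<in>upper_half_plane.
      ennreal (cmod (F (\<phi> z) * deriv \<phi> z) powr p * Im z powr (p - 2)) \<partial>lborel)"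
  proof (rule nn_energy_conformal[OF F open_upper_half_plane])
    show "\<phi> holomorphic_on upper_half_plane"
      unfolding \<phi>_def by (intro holomorphic_intros)
    show "inj_on \<phi> upper_half_plane"
      using w by (auto simp: inj_on_def \<phi>_def)
    show "\<phi> ` upper_half_plane = upper_half_plane"
    proof
      show "\<phi> ` upper_half_plane \<subseteq> upper_half_plane"
        using w by (auto simp: \<phi>_def upper_half_plane_def)
      show "upper_half_plane \<subseteq> \<phi> ` upper_half_plane"
      proof
        fix x assume x: "x \<in> upper_half_plane"
        have "Im ((x - of_real (Re w)) / of_real (Im w)) = Im x / Im w"
          by (simp only: Im_divide_of_real) simp
        then have "(x - of_real (Re w)) / of_real (Im w) \<in> upper_half_plane"
          using x w by (simp add: upper_half_plane_def)
        moreover have "\<phi> ((x - of_real (Re w)) / of_real (Im w)) = x"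
          using w by (simp add: \<phi>_def)
        ultimately show "x \<in> \<phi> ` upper_half_plane" by (metis imageI)
      qed
    qed
    show "Im z > 0 \<and> Im (\<phi> z) = Im z * cmod (deriv \<phi> z)" if "z \<in> upper_half_plane" for z
      using that w by (simp add: upper_half_plane_def d) (simp add: \<phi>_def)
  qed
  also have "\<dots> = nn_energy p (recentre w F)"
    by (simp add: nn_energy_def recentre_def d) (simp add: \<phi>_def)
  finally show ?thesis ..
qed

lemma recentre_height:
  assumes "Im w > 0"
  shows "cmod (recentre w F z) * Im z = cmod (F (of_real (Re w) + of_real (Im w) * z))
     * Im (of_real (Re w) + of_real (Im w) * z)"
  using assms by (simp add: recentre_def norm_mult)

definition cayley :: "complex \<Rightarrow> complex" where
  "cayley w = \<i> * (1 + w) / (1 - w)"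

lemma deriv_cayley:
  assumes "w \<noteq> 1"
  shows "deriv cayley w = 2 * \<i> / (1 - w)\<^sup>2"
  unfolding cayley_def
  using assms by (intro DERIV_imp_deriv)
    (auto intro!: derivative_eq_intros simp: field_simps power2_eq_square)

lemma Im_cayley:
  assumes "w \<noteq> 1"
  shows "Im (cayley w) = (1 - (cmod w)\<^sup>2) / (cmod (1 - w))\<^sup>2"
proof -
  have nz: "1 - w \<noteq> 0" "cnj (1 - w) \<noteq> 0"
    using assms by (simp_all add: complex_eq_iff)
  have "cayley w = (\<i> * (1 + w) * cnj (1 - w)) / ((1 - w) * cnj (1 - w))"
    unfolding cayley_def by (rule nonzero_mult_divide_mult_cancel_right[OF nz(2), symmetric])
  then have "cayley w = \<i> * ((1 + w) * cnj (1 - w)) / of_real ((cmod (1 - w))\<^sup>2)"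
    by (simp only: complex_norm_square mult.assoc)
  then have "Im (cayley w) = Re ((1 + w) * cnj (1 - w)) / (cmod (1 - w))\<^sup>2"
    by (simp only: Im_divide_of_real) simp
  also have "Re ((1 + w) * cnj (1 - w)) = 1 - (cmod w)\<^sup>2"
    unfolding cmod_power2 by (simp add: algebra_simps power2_eq_square)
  finally show ?thesis .
qed

lemma cayley_image: "cayley ` ball 0 1 = upper_half_plane"
proof
  show "cayley ` ball 0 1 \<subseteq> upper_half_plane"
  proof clarify
    fix w :: complex assume w: "w \<in> ball 0 1"
    then have "w \<noteq> 1" "(cmod w)\<^sup>2 < 1" by (auto simp: abs_square_less_1)
    then show "cayley w \<in> upper_half_plane"
      by (simp add: upper_half_plane_def Im_cayley)
  qed
  show "upper_half_plane \<subseteq> cayley ` ball 0 1"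
  proof
    fix z assume z: "z \<in> upper_half_plane"
    then have z0: "z + \<i> \<noteq> 0" "Im z > 0"
      by (auto simp: upper_half_plane_def complex_eq_iff)
    define w where "w = (z - \<i>) / (z + \<i>)"
    have "(cmod (z - \<i>))\<^sup>2 < (cmod (z + \<i>))\<^sup>2"
      unfolding cmod_power2 using z0 by (simp add: power2_eq_square algebra_simps)
    then have "cmod (z - \<i>) < cmod (z + \<i>)"
      using power2_less_imp_less by fastforce
    then have "w \<in> ball 0 1" using z0 by (simp add: w_def norm_divide)
    moreover have "cayley w = z"
    proof -
      have "1 + w = 2 * z / (z + \<i>)" "1 - w = 2 * \<i> / (z + \<i>)"
        using z0 by (simp_all add: w_def field_simps)
      then show ?thesis using z0 by (simp add: cayley_def)
    qed
    ultimately show "z \<in> cayley ` ball 0 1" by blast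
  qed
qed

lemma cayley_holomorphic: "cayley holomorphic_on ball 0 1"
  unfolding cayley_def by (intro holomorphic_intros) auto

lemma inj_on_cayley: "inj_on cayley (ball 0 1)"
proof (rule inj_onI)
  fix v w assume vw: "v \<in> ball 0 1" "w \<in> ball 0 1" "cayley v = cayley w"
  then have "1 - v \<noteq> 0" "1 - w \<noteq> 0" by auto
  with vw(3) have "(1 + v) * (1 - w) = (1 + w) * (1 - v)"
    by (simp add: cayley_def field_simps)
  then show "v = w" by (simp add: algebra_simps)
qed

text \<open>
  The unitary transport to the Bergman space of the disc.
\<close>

definition to_disc :: "(complex \<Rightarrow> complex) \<Rightarrow> complex \<Rightarrow> complex" where
  "to_disc F = (\<lambda>w. F (cayley w) * deriv cayley w)"

lemma to_disc_holomorphic: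
  assumes "F holomorphic_on upper_half_plane"
  shows "to_disc F holomorphic_on ball 0 1"
proof -
  have "(F \<circ> cayley) holomorphic_on ball 0 1"
    by (rule holomorphic_on_compose_gen[OF cayley_holomorphic assms]) (simp add: cayley_image)
  then have "(\<lambda>w. (F \<circ> cayley) w * deriv cayley w) holomorphic_on ball 0 1"
    by (rule holomorphic_on_mult) (intro holomorphic_deriv cayley_holomorphic open_ball)
  then show ?thesis by (simp add: to_disc_def o_def)
qed

text \<open>
  The hypothesis of \<open>nn_energy_conformal\<close>: on the disc the height is replaced by \<open>(1 - |w|\<^sup>2) / 2\<close>.
\<close>

lemma Im_cayley_deriv:
  assumes "w \<in> ball 0 1"
  shows "(1 - (cmod w)\<^sup>2) / 2 > 0" "Im (cayley w) = (1 - (cmod w)\<^sup>2) / 2 * cmod (deriv cayley w)"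
proof -
  have "w \<noteq> 1" "(cmod w)\<^sup>2 < 1" using assms by (auto simp: abs_square_less_1)
  then show "(1 - (cmod w)\<^sup>2) / 2 > 0"
    "Im (cayley w) = (1 - (cmod w)\<^sup>2) / 2 * cmod (deriv cayley w)"
    by (simp_all add: Im_cayley deriv_cayley norm_divide norm_mult norm_power field_simps)
qed

lemma nn_energy_to_disc:
  assumes F: "F holomorphic_on upper_half_plane"
  shows "nn_energy p F = (\<integral>\<^sup>+w\<in>ball 0 1.
     ennreal (cmod (to_disc F w) powr p * ((1 - (cmod w)\<^sup>2) / 2) powr (p - 2)) \<partial>lborel)"
  unfolding to_disc_def
  by (rule nn_energy_conformal[OF F _ cayley_holomorphic inj_on_cayley cayley_image])
     (use Im_cayley_deriv in auto)

lemma to_disc_height: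
  assumes "w \<in> ball 0 1"
  shows "cmod (F (cayley w)) * Im (cayley w) = cmod (to_disc F w) * (1 - (cmod w)\<^sup>2) / 2"
  unfolding Im_cayley_deriv(2)[OF assms] by (simp add: to_disc_def norm_mult)

section \<open>The sharp pointwise bound\<close>

lemma set_integral_of_nn_integral:
  fixes f :: "complex \<Rightarrow> real"
  assumes "(\<lambda>z. indicator S z *\<^sub>R f z) \<in> borel_measurable borel" "\<And>z. z \<in> S \<Longrightarrow> 0 \<le> f z"
    and "(\<integral>\<^sup>+z\<in>S. ennreal (f z) \<partial>lborel) = ennreal x" "0 \<le> x"
  shows "set_integrable lborel S f" "(LINT z:S|lborel. f z) = x"
proof -
  have "(\<integral>\<^sup>+z. ennreal (indicator S z *\<^sub>R f z) \<partial>lborel) = (\<integral>\<^sup>+z\<in>S. ennreal (f z) \<partial>lborel)"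
    by (intro nn_integral_cong) (simp split: split_indicator)
  also have "\<dots> = ennreal x" by (rule assms(3))
  finally have "integrable lborel (\<lambda>z. indicator S z *\<^sub>R f z)
      \<and> (LINT z|lborel. indicator S z *\<^sub>R f z) = x"
    using assms by (subst (asm) nn_integral_eq_integrable) (auto simp: indicator_def)
  then show "set_integrable lborel S f" "(LINT z:S|lborel. f z) = x"
    by (simp_all add: set_integrable_def set_lebesgue_integral_def)
qed

lemma bergman_holomorphic: "F \<in> bergman_space \<Longrightarrow> F holomorphic_on upper_half_plane"
  by (simp add: bergman_space_def)

lemma bergman_integrable:
  "F \<in> bergman_space \<Longrightarrow> set_integrable lborel upper_half_plane (\<lambda>z. (cmod (F z))\<^sup>2)"
  by (simp add: bergman_space_def)

lemma nn_energy_two_bergman: "F \<in> bergman_space \<Longrightarrow> nn_energy 2 F = ennreal (energy 2 F)"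
  by (intro nn_energy_eq_energy) (auto simp: bergman_space_iff)

lemma holomorphic_norm_square_measurable:
  assumes "f holomorphic_on S" "S \<in> sets borel"
  shows "(\<lambda>z. indicator S z *\<^sub>R (cmod (f z))\<^sup>2) \<in> borel_measurable borel"
  using assms holomorphic_on_imp_continuous_on
  by (intro borel_measurable_continuous_on_indicator continuous_intros)

lemma to_disc_norm:
  assumes F: "F \<in> bergman_space"
  shows "set_integrable lborel (ball 0 1) (\<lambda>w. (cmod (to_disc F w))\<^sup>2)"
    and "(LINT w:ball 0 1|lborel. (cmod (to_disc F w))\<^sup>2) = energy 2 F"
proof -
  have hol: "to_disc F holomorphic_on ball 0 1"
    using F by (intro to_disc_holomorphic bergman_holomorphic)
  have meas: "(\<lambda>z. indicator (ball 0 1) z *\<^sub>R (cmod (to_disc F z))\<^sup>2) \<in> borel_measurable borel"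
    by (rule holomorphic_norm_square_measurable[OF hol]) simp
  have "nn_energy 2 F = (\<integral>\<^sup>+w\<in>ball 0 1.
     ennreal (cmod (to_disc F w) powr 2 * ((1 - (cmod w)\<^sup>2) / 2) powr (2 - 2)) \<partial>lborel)"
    by (rule nn_energy_to_disc) (rule bergman_holomorphic[OF F])
  also have "\<dots> = (\<integral>\<^sup>+w\<in>ball 0 1. ennreal ((cmod (to_disc F w))\<^sup>2) \<partial>lborel)"
  proof (intro nn_integral_cong)
    fix w :: complex
    show "ennreal (cmod (to_disc F w) powr 2 * ((1 - (cmod w)\<^sup>2) / 2) powr (2 - 2)) * indicator (ball 0 1) w
        = ennreal ((cmod (to_disc F w))\<^sup>2) * indicator (ball 0 1) w"
      using Im_cayley_deriv(1)[of w] by (cases "w \<in> ball 0 1") auto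
  qed
  finally have eq: "(\<integral>\<^sup>+w\<in>ball 0 1. ennreal ((cmod (to_disc F w))\<^sup>2) \<partial>lborel) = ennreal (energy 2 F)"
    using nn_energy_two_bergman[OF F] by simp
  show "set_integrable lborel (ball 0 1) (\<lambda>w. (cmod (to_disc F w))\<^sup>2)"
    and "(LINT w:ball 0 1|lborel. (cmod (to_disc F w))\<^sup>2) = energy 2 F"
    using set_integral_of_nn_integral[OF meas _ eq] energy_nonneg by auto
qed

lemma recentre_bergman:
  assumes "F \<in> bergman_space" "Im w > 0"
  shows "recentre w F \<in> bergman_space" 
  using assms by (simp add: bergman_space_iff recentre_holomorphic nn_energy_recentre)

lemma energy_recentre:
  assumes "F \<in> bergman_space" "Im w > 0"
  shows "energy 2 (recentre w F) = energy 2 F"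
proof -
  have "ennreal (energy 2 (recentre w F)) = ennreal (energy 2 F)"
    using assms recentre_bergman[OF assms]
    by (simp add: nn_energy_two_bergman[symmetric] nn_energy_recentre bergman_holomorphic)
  then show ?thesis by (simp add: energy_nonneg)
qed

text \<open>
  After recentring, \<open>z\<close> corresponds to the origin of the disc, where the bound is the mean value
  inequality over the whole disc. Equality holds for the reproducing kernel at \<open>z\<close>, so the constant
  cannot be improved.
\<close>

lemma bergman_pointwise_bound:
  assumes F: "F \<in> bergman_space" and z: "z \<in> upper_half_plane"
  shows "4 * pi * (cmod (F z) * Im z)\<^sup>2 \<le> energy 2 F"
proof -
  have Im: "Im z > 0" using z by (simp add: upper_half_plane_def)
  define G where "G = recentre z F"
  have G: "G \<in> bergman_space" unfolding G_def by (rule recentre_bergman[OF F Im])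
  have "pi * 1\<^sup>2 * (cmod (to_disc G 0))\<^sup>2 \<le> (LINT w:ball 0 1|lborel. (cmod (to_disc G w))\<^sup>2)"
    by (rule norm_square_le_disc_mean[OF _ _ to_disc_norm(1)[OF G]])
       (use to_disc_holomorphic[OF bergman_holomorphic[OF G]] in auto)
  also have "\<dots> = energy 2 F"
    using to_disc_norm(2)[OF G] energy_recentre[OF F Im] by (simp add: G_def)
  finally have "pi * (cmod (to_disc G 0))\<^sup>2 \<le> energy 2 F" by simp
  moreover have "cmod (to_disc G 0) = 2 * (cmod (F z) * Im z)"
  proof -
    have "of_real (Re z) + of_real (Im z) * \<i> = z" by (simp add: complex_eq_iff)
    then have "cmod (G \<i>) = cmod (F z) * Im z"
      using recentre_height[OF Im, of F \<i>] by (simp add: G_def)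
    then show ?thesis by (simp add: to_disc_def deriv_cayley norm_mult) (simp add: cayley_def)
  qed
  ultimately show ?thesis by (simp add: power_mult_distrib)
qed

text \<open>
  Since \<open>(|F| y)\<^sup>p \<le> T\<^bsup>p - 2\<^esup> (|F| y)\<^sup>2\<close>.
\<close>

lemma nn_energy_le_sup:
  assumes F: "F holomorphic_on upper_half_plane" and p: "p \<ge> 2"
    and T: "\<And>z. z \<in> upper_half_plane \<Longrightarrow> cmod (F z) * Im z \<le> T"
  shows "nn_energy p F \<le> ennreal (T powr (p - 2)) * nn_energy 2 F"
proof -
  have "nn_energy p F \<le> (\<integral>\<^sup>+z. ennreal (T powr (p - 2)) * ennreal (indicator upper_half_plane z *\<^sub>R
     (cmod (F z) powr 2 * Im z powr (2 - 2))) \<partial>lborel)"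
    unfolding nn_energy_alt
  proof (intro nn_integral_mono)
    fix z :: complex
    show "ennreal (indicator upper_half_plane z *\<^sub>R (cmod (F z) powr p * Im z powr (p - 2)))
      \<le> ennreal (T powr (p - 2)) * ennreal (indicator upper_half_plane z *\<^sub>R
         (cmod (F z) powr 2 * Im z powr (2 - 2)))"
    proof (cases "z \<in> upper_half_plane")
      case True
      then have Im: "Im z > 0" by (simp add: upper_half_plane_def)
      have "cmod (F z) powr p = cmod (F z) powr (p - 2) * cmod (F z) powr 2"
        by (simp only: powr_add[symmetric]) simp
      then have "cmod (F z) powr p * Im z powr (p - 2)
         = (cmod (F z) * Im z) powr (p - 2) * cmod (F z) powr 2"
        using Im by (simp add: powr_mult)
      also have "\<dots> \<le> T powr (p - 2) * cmod (F z) powr 2"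
        using T[OF True] Im p by (intro mult_right_mono powr_mono2) auto
      finally show ?thesis
        using True Im by (simp add: ennreal_mult[symmetric] ennreal_leI)
    qed simp
  qed
  also have "\<dots> = ennreal (T powr (p - 2)) * nn_energy 2 F"
    unfolding nn_energy_alt using energy_density_measurable[OF F, of 2]
    by (intro nn_integral_cmult) simp
  finally show ?thesis .
qed

lemma nn_energy_bergman:
  assumes F: "F \<in> bergman_space" and p: "p \<ge> 2"
  shows "nn_energy p F = ennreal (energy p F)"
proof (rule nn_energy_eq_energy)
  show "F holomorphic_on upper_half_plane" by (rule bergman_holomorphic[OF F])
  have "cmod (F z) * Im z \<le> sqrt (energy 2 F / (4 * pi))" if "z \<in> upper_half_plane" for z
    by (rule real_le_rsqrt) (use bergman_pointwise_bound[OF F that] in \<open>simp add: field_simps\<close>)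
  from nn_energy_le_sup[OF bergman_holomorphic[OF F] p this]
  have "nn_energy p F \<le> ennreal (sqrt (energy 2 F / (4 * pi)) powr (p - 2)) * nn_energy 2 F" .
  also have "\<dots> < \<infinity>" by (simp add: nn_energy_two_bergman[OF F] ennreal_mult_less_top)
  finally show "nn_energy p F < \<infinity>" .
qed

lemma energy_le_sup:
  assumes F: "F \<in> bergman_space" and p: "p \<ge> 2"
    and T: "\<And>z. z \<in> upper_half_plane \<Longrightarrow> cmod (F z) * Im z \<le> T"
  shows "energy p F \<le> T powr (p - 2) * energy 2 F"
proof -
  have "ennreal (energy p F) \<le> ennreal (T powr (p - 2) * energy 2 F)"
    using nn_energy_le_sup[OF bergman_holomorphic[OF F] p T] F p
    by (simp add: nn_energy_bergman ennreal_mult energy_nonneg)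
  then show ?thesis by (simp add: energy_nonneg)
qed

text \<open>
  The height \<open>|F| y\<close> tends to \<open>0\<close> at the boundary and at infinity: the mean value inequality over a disc
  of radius \<open>y / 2\<close> bounds its square by the integral of \<open>|F|\<^sup>2\<close> over that disc, and this is small when the disc
  avoids a large compact set. So the supremum may be taken over a compact set.
\<close>

lemma half_plane_height_attains_max:
  assumes F: "F \<in> bergman_space"
  obtains w where "Im w > 0"
    "\<And>z. z \<in> upper_half_plane \<Longrightarrow> cmod (F z) * Im z \<le> cmod (F w) * Im w"
proof (cases "\<exists>v\<in>upper_half_plane. F v \<noteq> 0")
  case False
  then show ?thesis by (intro that[of \<i>]) auto
next
  case True
  then obtain v where v: "Im v > 0" "F v \<noteq> 0" by (auto simp: upper_half_plane_def)
  (* Points where the height is at least c will be confined to a compact set K'. *)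
  define c where "c = cmod (F v) * Im v"
  have c: "c > 0" using v by (simp add: c_def)
  have hol: "F holomorphic_on upper_half_plane" by (rule bergman_holomorphic[OF F])
  define K where "K n = cball 0 (real n + 1) \<inter> {z. 1 / (real n + 1) \<le> Im z}" for n
  define f where "f z = indicator upper_half_plane z *\<^sub>R (cmod (F z))\<^sup>2" for z
  have intf: "integrable lborel f"
    using bergman_integrable[OF F] by (simp add: set_integrable_def f_def[abs_def])
  have [measurable]: "f \<in> borel_measurable borel"
    using borel_measurable_integrable[OF intf] by simp
  have Kclosed: "closed (K n)" for n
    unfolding K_def by (intro closed_Int closed_cball closed_halfspace_Im_ge)
  have [measurable]: "K n \<in> sets borel" for n by (intro borel_closed Kclosed)
  have "(\<lambda>n. LINT z|lborel. indicator (- K n) z *\<^sub>R f z) \<longlonglongrightarrow> (LINT z::complex|lborel. (0::real))"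
  proof (rule integral_dominated_convergence[where w = f])
    show "AE z in lborel. (\<lambda>n. indicator (- K n) z *\<^sub>R f z) \<longlonglongrightarrow> 0"
    proof (intro AE_I2)
      fix z
      show "(\<lambda>n. indicator (- K n) z *\<^sub>R f z) \<longlonglongrightarrow> 0"
      proof (cases "Im z > 0")
        case False
        then show ?thesis by (simp add: f_def upper_half_plane_def)
      next
        case True
        have "\<forall>\<^sub>F n in sequentially. cmod z < real n"
          using filterlim_real_sequentially by (simp add: filterlim_at_top_dense)
        moreover have "\<forall>\<^sub>F n in sequentially. 1 / Im z < real n"
          using filterlim_real_sequentially by (simp add: filterlim_at_top_dense)
        ultimately have "\<forall>\<^sub>F n in sequentially. indicator (- K n) z *\<^sub>R f z = 0"
        proof eventually_elim
          case (elim n)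
          have "1 < real n * Im z" using elim(2) True by (simp add: field_simps)
          then have "1 / (real n + 1) \<le> Im z" using True by (simp add: field_simps)
          then show ?case using elim(1) by (simp add: K_def)
        qed
        then show ?thesis by (rule tendsto_eventually)
      qed
    qed
    show "AE z in lborel. norm (indicator (- K n) z *\<^sub>R f z) \<le> f z" for n
      by (intro AE_I2) (auto simp: f_def indicator_def)
  qed (use intf in auto)
  then have "\<forall>\<^sub>F n in sequentially. (LINT z|lborel. indicator (- K n) z *\<^sub>R f z) < pi * (c / 2)\<^sup>2"
    using c by (intro order_tendstoD) auto
  then obtain n where n: "(LINT z|lborel. indicator (- K n) z *\<^sub>R f z) < pi * (c / 2)\<^sup>2"
    by (auto simp: eventually_sequentially)
  define m where "m = real n + 1"
  have m: "m \<ge> 1" by (simp add: m_def)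
  (* If the disc around z of radius Im z / 2 meets K n at x, then Im z < 2 Im x and Im x < 3/2 Im z;
     hence the bounds that define K'. *)
  define K' where "K' = cball 0 (2 * m) \<inter> {z. 2 / (3 * m) \<le> Im z}"
  have out: "cmod (F z) * Im z < c" if z: "Im z > 0" "z \<notin> K'" for z
  proof -
    define R where "R = Im z / 2"
    have R: "R > 0" using z by (simp add: R_def)
    have near: "\<bar>Im x - Im z\<bar> < R \<and> cmod z \<le> cmod x + R" if "x \<in> ball z R" for x
    proof -
      have "cmod (x - z) < R" using that by (simp add: dist_norm norm_minus_commute)
      moreover have "\<bar>Im (x - z)\<bar> \<le> cmod (x - z)" by (rule abs_Im_le_cmod)
      moreover have "cmod z \<le> cmod x + cmod (z - x)" using norm_triangle_ineq[of x "z - x"] by simp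
      ultimately show ?thesis by (simp add: norm_minus_commute)
    qed
    have sub: "ball z R \<subseteq> upper_half_plane"
    proof
      fix x assume "x \<in> ball z R"
      from near[OF this] have "\<bar>Im x - Im z\<bar> < Im z / 2" by (simp add: R_def)
      then have "Im x > 0" using z by linarith
      then show "x \<in> upper_half_plane" by (simp add: upper_half_plane_def)
    qed
    have disj: "ball z R \<inter> K n = {}"
    proof (rule ccontr)
      assume "ball z R \<inter> K n \<noteq> {}"
      then obtain x where x: "x \<in> ball z R" "cmod x \<le> m" "1 / m \<le> Im x"
        by (auto simp: K_def m_def)
      have "\<bar>Im x\<bar> \<le> m" using x(2) abs_Im_le_cmod[of x] by linarith
      moreover have nx: "\<bar>Im x - Im z\<bar> < Im z / 2" "cmod z \<le> cmod x + Im z / 2"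
        using near[OF x(1)] by (simp_all add: R_def)
      ultimately have "cmod z \<le> 2 * m"
        using x(2) by linarith
      moreover have "2 / (3 * m) \<le> Im z"
      proof -
        have "1 / m < 3 / 2 * Im z" using nx(1) x(3) by linarith
        then show ?thesis using m by (simp add: field_simps)
      qed
      ultimately show False using z by (simp add: K'_def)
    qed
    have int1: "set_integrable lborel (ball z R) (\<lambda>x. (cmod (F x))\<^sup>2)"
      by (rule set_integrable_subset[OF bergman_integrable[OF F]]) (use sub in auto)
    have int2: "integrable lborel (\<lambda>x. indicator (- K n) x *\<^sub>R f x)"
      using intf by (intro integrable_mult_indicator) auto
    have "pi * R\<^sup>2 * (cmod (F z))\<^sup>2 \<le> (LINT x:ball z R|lborel. (cmod (F x))\<^sup>2)"
      by (rule norm_square_le_disc_mean[OF holomorphic_on_subset[OF hol sub] R int1])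
    also have "\<dots> \<le> (LINT x|lborel. indicator (- K n) x *\<^sub>R f x)"
      unfolding set_lebesgue_integral_def
    proof (rule integral_mono[OF int1[unfolded set_integrable_def] int2])
      fix x
      show "indicator (ball z R) x *\<^sub>R (cmod (F x))\<^sup>2 \<le> indicator (- K n) x *\<^sub>R f x"
        using sub disj by (auto simp: f_def indicator_def)
    qed
    also have "\<dots> < pi * (c / 2)\<^sup>2" by (rule n)
    finally have "(R * cmod (F z))\<^sup>2 < (c / 2)\<^sup>2"
      by (simp add: power_mult_distrib)
    then have "R * cmod (F z) < c / 2"
      using c by (intro power2_less_imp_less[of "R * cmod (F z)"]) auto
    then show ?thesis by (simp add: R_def mult.commute)
  qed
  have sub': "K' \<subseteq> upper_half_plane"
  proof
    fix z assume "z \<in> K'"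
    then have "2 / (3 * m) \<le> Im z" by (simp add: K'_def)
    moreover have "0 < 2 / (3 * m)" using m by simp
    ultimately have "0 < Im z" by (rule order.strict_trans2[rotated])
    then show "z \<in> upper_half_plane" by (simp add: upper_half_plane_def)
  qed
  have "compact K'"
    unfolding K'_def by (intro compact_Int_closed compact_cball closed_halfspace_Im_ge)
  moreover have vK: "v \<in> K'" using out[of v] v by (auto simp: c_def)
  moreover have "continuous_on K' (\<lambda>z. cmod (F z) * Im z)"
    using continuous_on_subset[OF holomorphic_on_imp_continuous_on[OF hol] sub']
    by (intro continuous_intros)
  ultimately obtain w where w: "w \<in> K'" "\<And>z. z \<in> K' \<Longrightarrow> cmod (F z) * Im z \<le> cmod (F w) * Im w"
    using continuous_attains_sup[of K' "\<lambda>z. cmod (F z) * Im z"] by blast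
  show ?thesis
  proof (rule that[of w])
    show "Im w > 0" using w(1) sub' by (auto simp: upper_half_plane_def)
    fix z assume z: "z \<in> upper_half_plane"
    show "cmod (F z) * Im z \<le> cmod (F w) * Im w"
    proof (cases "z \<in> K'")
      case False
      then have "cmod (F z) * Im z < c" using out[of z] z by (simp add: upper_half_plane_def)
      also have "c \<le> cmod (F w) * Im w" using w(2)[OF vK] by (simp add: c_def)
      finally show ?thesis by simp
    qed (rule w(2))
  qed
qed

section \<open>The Brezis-Lieb splitting\<close>

text \<open>
  Either \<open>a\<close> is so small compared with \<open>b\<close> that it costs only the factor \<open>1 + \<delta>\<close>, or \<open>b\<close> is bounded by a
  multiple of \<open>a\<close>.
\<close>

lemma powr_norm_add_le:
  fixes p \<delta> :: real
  assumes p: "p > 0" and \<delta>: "\<delta> > 0"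
  obtains C where "C \<ge> 0"
    "\<And>a b :: 'a::real_normed_vector. norm (a + b) powr p \<le> (1 + \<delta>) * norm b powr p + C * norm a powr p"
proof -
  define e where "e = (1 + \<delta>) powr (1 / p) - 1"
  have e: "e > 0" using p \<delta> by (simp add: e_def gr_one_powr)
  have ep: "(1 + e) powr p = 1 + \<delta>" using p \<delta> by (simp add: e_def powr_powr)
  define C where "C = (1 + 1 / e) powr p"
  have "norm (a + b) powr p \<le> (1 + \<delta>) * norm b powr p + C * norm a powr p" for a b :: 'a
  proof (cases "norm a \<le> e * norm b")
    case True
    have "norm (a + b) \<le> (1 + e) * norm b"
      using norm_triangle_ineq[of a b] True by (simp add: algebra_simps)
    then have "norm (a + b) powr p \<le> ((1 + e) * norm b) powr p"
      using p by (intro powr_mono2) auto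
    also have "\<dots> = (1 + \<delta>) * norm b powr p" using e by (simp add: powr_mult ep)
    also have "\<dots> \<le> (1 + \<delta>) * norm b powr p + C * norm a powr p" by (simp add: C_def)
    finally show ?thesis .
  next
    case False
    have "norm b \<le> norm a / e" using False e by (simp add: field_simps)
    then have "norm (a + b) \<le> (1 + 1 / e) * norm a"
      using norm_triangle_ineq[of a b] by (simp add: algebra_simps)
    then have "norm (a + b) powr p \<le> ((1 + 1 / e) * norm a) powr p"
      using p by (intro powr_mono2) auto
    also have "\<dots> = C * norm a powr p" using e by (simp add: powr_mult C_def)
    also have "\<dots> \<le> (1 + \<delta>) * norm b powr p + C * norm a powr p" using \<delta> by simp
    finally show ?thesis .
  qed
  then show thesis by (intro that[of C]) (auto simp: C_def)
qed

text \<open>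
  The previous inequality for the pair \<open>a, b\<close> and for the pair \<open>-a, a + b\<close>, which recovers \<open>b\<close>.
\<close>

lemma powr_norm_add_diff_le:
  fixes p \<eta> :: real
  assumes p: "p > 0" and \<eta>: "\<eta> > 0"
  obtains C where "C \<ge> 0"
    "\<And>a b :: 'a::real_normed_vector.
       \<bar>norm (a + b) powr p - norm b powr p\<bar> \<le> \<eta> * norm b powr p + C * norm a powr p"
proof -
  define \<delta> where "\<delta> = min 1 (\<eta> / 2)"
  have \<delta>: "\<delta> > 0" "\<delta> \<le> 1" "\<delta> \<le> \<eta> / 2" using \<eta> by (auto simp: \<delta>_def)
  obtain C where C: "C \<ge> 0"
    "\<And>a b :: 'a. norm (a + b) powr p \<le> (1 + \<delta>) * norm b powr p + C * norm a powr p"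
    using powr_norm_add_le[OF p \<delta>(1)] by blast
  have "\<bar>norm (a + b) powr p - norm b powr p\<bar> \<le> \<eta> * norm b powr p + (2 * C) * norm a powr p" for a b :: 'a
  proof -
    define A B S where "A = norm a powr p" "B = norm b powr p" "S = norm (a + b) powr p"
    have nn: "A \<ge> 0" "B \<ge> 0" "S \<ge> 0" by (auto simp: A_B_S_def)
    have 1: "S \<le> (1 + \<delta>) * B + C * A" using C(2)[of a b] by (simp add: A_B_S_def)
    have 2: "B \<le> (1 + \<delta>) * S + C * A" using C(2)[of "- a" "a + b"] by (simp add: A_B_S_def)
    have CA: "0 \<le> C * A" using C(1) nn by simp
    have dB: "\<delta> * B \<le> \<eta> / 2 * B" by (rule mult_right_mono[OF \<delta>(3) nn(2)])
    have "\<delta> * S \<le> \<delta> * ((1 + \<delta>) * B + C * A)" using 1 \<delta>(1) by (intro mult_left_mono) auto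
    also have "\<dots> = \<delta> * B + \<delta> * (\<delta> * B) + \<delta> * (C * A)" by (simp add: algebra_simps)
    also have "\<dots> \<le> \<delta> * B + 1 * (\<delta> * B) + 1 * (C * A)"
      using \<delta> nn CA by (intro add_mono mult_right_mono order.refl) auto
    finally have dS: "\<delta> * S \<le> 2 * (\<delta> * B) + C * A" by linarith
    have \<eta>B: "0 \<le> \<eta> * B" "\<eta> / 2 * B = (\<eta> * B) / 2" using \<eta> nn by simp_all
    have "S - B \<le> \<eta> * B + 2 * (C * A)" using 1 dB CA \<eta>B unfolding distrib_right by linarith
    moreover have "B - S \<le> \<eta> * B + 2 * (C * A)" using 2 dS dB \<eta>B unfolding distrib_right by linarith
    ultimately show ?thesis by (simp add: A_B_S_def abs_le_iff mult.assoc)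
  qed
  then show thesis using C(1) by (intro that[of "2 * C"]) auto
qed

text \<open>
  Along a bounded sequence that converges pointwise, the \<open>p\<close>-th power integral splits asymptotically into
  that of the limit and that of the difference. The integrand of the defect is dominated by an integrable
  function only up to \<open>\<eta>\<close> times the bounded quantity \<open>|f n - g|\<^sup>p\<close>, so that quantity is subtracted before
  dominated convergence is applied, and \<open>\<eta>\<close> is arbitrary.
\<close>

lemma brezis_lieb:
  fixes f :: "nat \<Rightarrow> 'b \<Rightarrow> complex"
  assumes p: "p > 0"
    and meas [measurable]: "\<And>n. f n \<in> borel_measurable M" "g \<in> borel_measurable M"
    and lim: "\<And>x. x \<in> space M \<Longrightarrow> (\<lambda>n. f n x) \<longlonglongrightarrow> g x"
    and int_f: "\<And>n. integrable M (\<lambda>x. cmod (f n x) powr p)"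
    and int_g: "integrable M (\<lambda>x. cmod (g x) powr p)"
    and bound: "\<And>n. (LINT x|M. cmod (f n x) powr p) \<le> B"
  shows "(\<lambda>n. (LINT x|M. cmod (f n x) powr p) - (LINT x|M. cmod (f n x - g x) powr p))
           \<longlonglongrightarrow> (LINT x|M. cmod (g x) powr p)"
proof -
  obtain C0 where C0: "C0 \<ge> 0" "\<And>a b :: complex. cmod (a + b) powr p \<le> (1 + 1) * cmod b powr p + C0 * cmod a powr p"
    using powr_norm_add_le[OF p zero_less_one] by blast
  have le: "cmod (f n x - g x) powr p \<le> 2 * cmod (f n x) powr p + C0 * cmod (g x) powr p" for n x
    using C0(2)[of "- g x" "f n x"] by simp
  have int_d: "integrable M (\<lambda>x. cmod (f n x - g x) powr p)" for n
    by (rule Bochner_Integration.integrable_bound[where f = "\<lambda>x. 2 * cmod (f n x) powr p + C0 * cmod (g x) powr p"])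
       (use int_f int_g le C0(1) in \<open>auto intro!: AE_I2 order.trans[OF le]\<close>)
  define B' where "B' = 2 * B + C0 * (LINT x|M. cmod (g x) powr p)"
  have bound_d: "(LINT x|M. cmod (f n x - g x) powr p) \<le> B'" for n
  proof -
    have "(LINT x|M. cmod (f n x - g x) powr p)
        \<le> (LINT x|M. 2 * cmod (f n x) powr p + C0 * cmod (g x) powr p)"
      using int_f int_g by (intro integral_mono int_d le) auto
    also have "\<dots> = 2 * (LINT x|M. cmod (f n x) powr p) + C0 * (LINT x|M. cmod (g x) powr p)"
      using int_f int_g by simp
    also have "\<dots> \<le> B'" using bound[of n] by (simp add: B'_def)
    finally show ?thesis .
  qed
  have "0 \<le> (LINT x|M. cmod (f 0 x - g x) powr p)" by simp
  then have B': "B' \<ge> 0" using bound_d[of 0] by linarith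
  define D where "D n x = cmod (f n x) powr p - cmod (f n x - g x) powr p - cmod (g x) powr p" for n x
  have int_D: "integrable M (D n)" for n
    unfolding D_def using int_f int_g int_d by auto
  have "(\<lambda>n. LINT x|M. D n x) \<longlonglongrightarrow> 0"
  proof (rule LIMSEQ_I)
    fix e :: real assume e: "e > 0"
    define \<eta> where "\<eta> = e / (2 * (B' + 1))"
    have \<eta>: "\<eta> > 0" using e B' by (simp add: \<eta>_def)
    have \<eta>B: "\<eta> * B' \<le> e / 2"
    proof -
      have "\<eta> * B' \<le> \<eta> * (B' + 1)" using \<eta> by simp
      also have "\<dots> = e / 2" using B' by (simp add: \<eta>_def field_simps)
      finally show ?thesis .
    qed
    obtain C where C: "C \<ge> 0"
      "\<And>a b :: complex. \<bar>cmod (a + b) powr p - cmod b powr p\<bar> \<le> \<eta> * cmod b powr p + C * cmod a powr p"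
      using powr_norm_add_diff_le[OF p \<eta>] by blast
    (* the part of the defect that is dominated *)
    define W where "W n x = max 0 (\<bar>D n x\<bar> - \<eta> * cmod (f n x - g x) powr p)" for n x
    have W_le: "W n x \<le> (C + 1) * cmod (g x) powr p" for n x
    proof -
      have "\<bar>cmod (f n x) powr p - cmod (f n x - g x) powr p\<bar>
          \<le> \<eta> * cmod (f n x - g x) powr p + C * cmod (g x) powr p"
        using C(2)[of "g x" "f n x - g x"] by simp
      moreover have g0: "0 \<le> cmod (g x) powr p" by simp
      ultimately have "\<bar>D n x\<bar> \<le> \<eta> * cmod (f n x - g x) powr p + (C + 1) * cmod (g x) powr p"
        unfolding D_def distrib_right by linarith
      moreover have "0 \<le> (C + 1) * cmod (g x) powr p" using C(1) by (intro mult_nonneg_nonneg) auto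
      ultimately show ?thesis
        unfolding W_def by (intro max.boundedI) linarith+
    qed
    have [measurable]: "D n \<in> borel_measurable M" for n using int_D by (rule borel_measurable_integrable)
    have "(\<lambda>n. LINT x|M. W n x) \<longlonglongrightarrow> (LINT x|M. 0)"
    proof (rule integral_dominated_convergence[where w = "\<lambda>x. (C + 1) * cmod (g x) powr p"])
      show "integrable M (\<lambda>x. (C + 1) * cmod (g x) powr p)" using int_g by simp
      show "W n \<in> borel_measurable M" for n unfolding W_def by measurable
      show "AE x in M. norm (W n x) \<le> (C + 1) * cmod (g x) powr p" for n
        using W_le by (intro AE_I2) (simp add: W_def)
      show "AE x in M. (\<lambda>n. W n x) \<longlonglongrightarrow> 0"
      proof (intro AE_I2)
        fix x assume x: "x \<in> space M"
        have 1: "(\<lambda>n. cmod (f n x) powr p) \<longlonglongrightarrow> cmod (g x) powr p"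
          using p by (intro tendsto_powr' tendsto_norm lim[OF x] tendsto_const) auto
        have "(\<lambda>n. cmod (f n x - g x)) \<longlonglongrightarrow> 0"
          using tendsto_norm[OF tendsto_diff[OF lim[OF x] tendsto_const[of "g x"]]] by simp
        then have 2: "(\<lambda>n. cmod (f n x - g x) powr p) \<longlonglongrightarrow> 0"
          using tendsto_powr'[OF _ tendsto_const[of p], of "\<lambda>n. cmod (f n x - g x)" 0] p by simp
        have "(\<lambda>n. W n x) \<longlonglongrightarrow> max 0 (\<bar>cmod (g x) powr p - 0 - cmod (g x) powr p\<bar> - \<eta> * 0)"
          unfolding W_def D_def by (intro tendsto_intros 1 2)
        then show "(\<lambda>n. W n x) \<longlonglongrightarrow> 0" by simp
      qed
    qed simp
    then have "(\<lambda>n. LINT x|M. W n x) \<longlonglongrightarrow> 0" by simp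
    from order_tendstoD(2)[OF this, of "e / 2"] e
    obtain N where N: "\<And>n. n \<ge> N \<Longrightarrow> (LINT x|M. W n x) < e / 2"
      by (auto simp: eventually_sequentially)
    have int_W: "integrable M (W n)" for n
      unfolding W_def using int_D int_d by (intro integrable_max) auto
    show "\<exists>N. \<forall>n\<ge>N. norm ((LINT x|M. D n x) - 0) < e"
    proof (intro exI allI impI)
      fix n assume n: "n \<ge> N"
      have "norm (LINT x|M. D n x) \<le> (LINT x|M. \<bar>D n x\<bar>)"
        using integral_norm_bound[of M "D n"] by simp
      also have "\<dots> \<le> (LINT x|M. W n x + \<eta> * cmod (f n x - g x) powr p)"
        using int_D int_W int_d by (intro integral_mono) (auto simp: W_def)
      also have "\<dots> = (LINT x|M. W n x) + \<eta> * (LINT x|M. cmod (f n x - g x) powr p)"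
        using int_W int_d by simp
      also have "\<dots> < e / 2 + \<eta> * B'"
        using N[OF n] bound_d[of n] \<eta> by (intro add_less_le_mono mult_left_mono) auto
      also have "\<dots> \<le> e" using \<eta>B by simp
      finally show "norm ((LINT x|M. D n x) - 0) < e" by simp
    qed
  qed
  then have "(\<lambda>n. (LINT x|M. D n x) + (LINT x|M. cmod (g x) powr p)) \<longlonglongrightarrow> 0 + (LINT x|M. cmod (g x) powr p)"
    by (intro tendsto_intros)
  moreover have "(LINT x|M. D n x) + (LINT x|M. cmod (g x) powr p)
      = (LINT x|M. cmod (f n x) powr p) - (LINT x|M. cmod (f n x - g x) powr p)" for n
    unfolding D_def using int_f int_g int_d by simp
  ultimately show ?thesis by simp
qed

section \<open>The reproducing kernel as a competitor\<close>

text \<open>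
  The sublevel sets of \<open>|w|\<^sup>2\<close> are discs, so under area measure on the unit disc \<open>1 - |w|\<^sup>2\<close> is uniformly
  distributed on the unit interval, with total mass \<open>\<pi>\<close>.
\<close>

lemma nn_integral_disc_radial:
  fixes h :: "real \<Rightarrow> ennreal"
  assumes [measurable]: "h \<in> borel_measurable borel"
  shows "(\<integral>\<^sup>+w\<in>ball (0::complex) 1. h (1 - (cmod w)\<^sup>2) \<partial>lborel) = ennreal pi * (\<integral>\<^sup>+t\<in>{0..1}. h t \<partial>lborel)"
proof -
  have [measurable]: "(indicator (ball (0::complex) 1) :: complex \<Rightarrow> ennreal) \<in> borel_measurable borel"
    by (intro borel_measurable_indicator) auto
  define M where "M = distr (density lborel (indicator (ball (0::complex) 1))) borel (\<lambda>w. 1 - (cmod w)\<^sup>2)"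
  define N where "N = density lborel (\<lambda>t::real. ennreal pi * indicator {0..1} t)"
  have eM: "emeasure M {x<..} = ennreal (pi * (1 - max 0 (min 1 x)))" for x
  proof -
    define r where "r = sqrt (1 - max 0 (min 1 x))"
    have r: "0 \<le> r" "r\<^sup>2 = 1 - max 0 (min 1 x)" by (auto simp: r_def)
    have level: "(x < 1 - c \<and> c < 1) \<longleftrightarrow> c < 1 - max 0 (min 1 x)" if "0 \<le> c" for c :: real
      using that by (auto simp: max_def min_def)
    define P where "P = (\<lambda>w. 1 - (cmod w)\<^sup>2) -` {x<..}"
    have P [measurable]: "P \<in> sets borel"
      unfolding P_def by (intro measurable_sets_borel[of _ borel]) auto
    have "emeasure M {x<..} = emeasure (density lborel (indicator (ball (0::complex) 1))) P"
      unfolding M_def P_def by (subst emeasure_distr) auto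
    also have "\<dots> = (\<integral>\<^sup>+w. indicator (ball (0::complex) 1) w * indicator P w \<partial>lborel)"
      using P by (intro emeasure_density borel_measurable_indicator) auto
    also have "\<dots> = emeasure lborel (P \<inter> ball (0::complex) 1)"
      by (subst nn_integral_indicator[symmetric], simp, intro nn_integral_cong)
         (simp split: split_indicator)
    also have "P \<inter> ball (0::complex) 1 = (\<lambda>w. 1 - (cmod w)\<^sup>2) -` {x<..} \<inter> ball (0::complex) 1"
      by (simp add: P_def)
    also have "(\<lambda>w. 1 - (cmod w)\<^sup>2) -` {x<..} \<inter> ball (0::complex) 1 = ball 0 r"
    proof (rule set_eqI)
      fix w :: complex
      have "w \<in> ball 0 r \<longleftrightarrow> (cmod w)\<^sup>2 < r\<^sup>2"
        using r(1) by (auto intro: power_strict_mono power2_less_imp_less)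
      moreover have "w \<in> ball 0 1 \<longleftrightarrow> (cmod w)\<^sup>2 < 1" by (simp add: abs_square_less_1)
      ultimately show "w \<in> (\<lambda>w. 1 - (cmod w)\<^sup>2) -` {x<..} \<inter> ball 0 1 \<longleftrightarrow> w \<in> ball 0 r"
        using level[of "(cmod w)\<^sup>2"] r(2) by auto
    qed
    also have "emeasure lborel (ball (0::complex) r) = ennreal (pi * r\<^sup>2)"
      using r(1) by (subst emeasure_ball) (auto simp: unit_ball_vol_2)
    finally show ?thesis by (simp add: r(2))
  qed
  have eN: "emeasure N {x<..} = ennreal (pi * (1 - max 0 (min 1 x)))" for x
  proof -
    have "emeasure N {x<..} = ennreal pi * emeasure lborel ({0..1} \<inter> {x<..})"
      unfolding N_def by (subst emeasure_density)
       (auto simp: mult.assoc indicator_inter_arith[symmetric] nn_integral_cmult)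
    also have "{0..1} \<inter> {x<..} = (if x < 0 then {0..1} else {x<..1})" by auto
    also have "emeasure lborel \<dots> = ennreal (1 - max 0 (min 1 x))"
      by (auto simp: max_def min_def not_le)
    finally show ?thesis by (simp add: ennreal_mult')
  qed
  have "M = N"
    by (rule measure_eqI_lessThan) (simp_all add: eM eN, simp_all add: M_def N_def)
  have "(\<integral>\<^sup>+w\<in>ball (0::complex) 1. h (1 - (cmod w)\<^sup>2) \<partial>lborel) = (\<integral>\<^sup>+t. h t \<partial>M)"
    unfolding M_def
    by (subst nn_integral_distr, simp, simp, subst nn_integral_density)
       (auto intro!: nn_integral_cong simp: mult.commute)
  also have "\<dots> = (\<integral>\<^sup>+t. ennreal pi * (h t * indicator {0..1} t) \<partial>lborel)"
    unfolding \<open>M = N\<close> N_def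
    by (subst nn_integral_density) (auto intro!: nn_integral_cong simp: mult_ac)
  also have "\<dots> = ennreal pi * (\<integral>\<^sup>+t\<in>{0..1}. h t \<partial>lborel)"
    by (rule nn_integral_cmult) measurable
  finally show ?thesis .
qed

text \<open>
  The reproducing kernel at \<open>\<i>\<close>, up to the scalar that makes its transport to the disc the constant \<open>1\<close>.
\<close>

definition bergman_kernel_at_i :: "complex \<Rightarrow> complex" where
  "bergman_kernel_at_i z = 2 * \<i> / (z + \<i>)\<^sup>2"

lemma half_plane_add_i_nonzero: "z \<in> upper_half_plane \<Longrightarrow> z + \<i> \<noteq> 0"
  by (auto simp: upper_half_plane_def complex_eq_iff)

lemma kernel_holomorphic: "bergman_kernel_at_i holomorphic_on upper_half_plane"
  unfolding bergman_kernel_at_i_def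
  by (intro holomorphic_intros) (use half_plane_add_i_nonzero in auto)

lemma to_disc_kernel:
  assumes "w \<noteq> 1"
  shows "to_disc bergman_kernel_at_i w = 1"
proof -
  have "1 - w \<noteq> 0" using assms by simp
  then have "cayley w + \<i> = 2 * \<i> / (1 - w)"
    by (simp add: cayley_def field_simps)
  then show ?thesis
    using assms by (simp add: to_disc_def bergman_kernel_at_i_def deriv_cayley power_divide power_mult_distrib)
qed

text \<open>
  On the disc this is the integral of a power of \<open>(1 - |w|\<^sup>2) / 2\<close>. For \<open>p = 2 s\<close>, division by \<open>\<pi>\<^sup>s\<close> gives the
  conjectured maximum.
\<close>

lemma nn_energy_kernel:
  assumes p: "p \<ge> 2"
  shows "nn_energy p bergman_kernel_at_i = ennreal (pi * 2 powr (2 - p) / (p - 1))"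
proof -
  have "nn_energy p bergman_kernel_at_i
      = (\<integral>\<^sup>+w\<in>ball (0::complex) 1. ennreal (((1 - (cmod w)\<^sup>2) / 2) powr (p - 2)) \<partial>lborel)"
    unfolding nn_energy_to_disc[OF kernel_holomorphic]
  proof (intro nn_integral_cong)
    fix w :: complex
    have "to_disc bergman_kernel_at_i w = 1" if "w \<in> ball 0 1"
      using that by (intro to_disc_kernel) auto
    then show "ennreal (cmod (to_disc bergman_kernel_at_i w) powr p * ((1 - (cmod w)\<^sup>2) / 2) powr (p - 2))
        * indicator (ball 0 1) w
      = ennreal (((1 - (cmod w)\<^sup>2) / 2) powr (p - 2)) * indicator (ball 0 1) w"
      by (cases "w \<in> ball 0 1") auto
  qed
  also have "\<dots> = ennreal pi * (\<integral>\<^sup>+t\<in>{0..1}. ennreal ((t / 2) powr (p - 2)) \<partial>lborel)"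
    by (rule nn_integral_disc_radial) measurable
  also have "(\<integral>\<^sup>+t\<in>{0..1}. ennreal ((t / 2) powr (p - 2)) \<partial>lborel) = ennreal (2 powr (2 - p) / (p - 1))"
  proof (rule nn_integral_has_integral_lebesgue')
    have "((\<lambda>t. t powr (p - 2)) has_integral 1 powr (p - 2 + 1) / (p - 2 + 1)) {0..1}"
      using p by (intro has_integral_powr_from_0) auto
    then have "((\<lambda>t. 2 powr (2 - p) * t powr (p - 2)) has_integral 2 powr (2 - p) * (1 / (p - 1))) {0..1}"
      by (intro has_integral_mult_right) simp
    then have "((\<lambda>t. (t / 2) powr (p - 2)) has_integral 2 powr (2 - p) * (1 / (p - 1))) {0..1}"
    proof (rule has_integral_eq[rotated])
      fix t :: real assume "t \<in> {0..1}"
      have "2 powr (2 - p) = 1 / 2 powr (p - 2)" by (simp add: powr_minus_divide[symmetric])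
      then show "2 powr (2 - p) * t powr (p - 2) = (t / 2) powr (p - 2)"
        using \<open>t \<in> {0..1}\<close> by (simp add: powr_divide)
    qed
    then show "((\<lambda>t. (t / 2) powr (p - 2)) has_integral 2 powr (2 - p) / (p - 1)) {0..1}" by simp
  qed simp
  finally show ?thesis by (simp add: ennreal_mult'[symmetric] algebra_simps)
qed

lemma kernel_bergman: "bergman_kernel_at_i \<in> bergman_space"
  using nn_energy_kernel[of 2] kernel_holomorphic by (simp add: bergman_space_iff)

lemma energy_kernel: "p \<ge> 2 \<Longrightarrow> energy p bergman_kernel_at_i = pi * 2 powr (2 - p) / (p - 1)"
  using nn_energy_kernel[of p] nn_energy_bergman[OF kernel_bergman, of p]
  by (simp add: energy_nonneg)

section \<open>Vector space structure and limits\<close>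

lemma energy_scale: "energy p (\<lambda>z. c * F z) = cmod c powr p * energy p F"
proof -
  have "energy p (\<lambda>z. c * F z) = (LINT z|lborel. cmod c powr p *
      (indicator upper_half_plane z *\<^sub>R (cmod (F z) powr p * Im z powr (p - 2))))"
    unfolding energy_def set_lebesgue_integral_def
    by (intro Bochner_Integration.integral_cong) (auto simp: norm_mult powr_mult indicator_def)
  then show ?thesis
    unfolding energy_def set_lebesgue_integral_def by (simp only: integral_mult_right_zero)
qed

lemma bergman_scale:
  assumes "F \<in> bergman_space"
  shows "(\<lambda>z. c * F z) \<in> bergman_space"
proof -
  have "set_integrable lborel upper_half_plane (\<lambda>z. (cmod c)\<^sup>2 * (cmod (F z))\<^sup>2)"
    using bergman_integrable[OF assms] by simp
  then show ?thesis
    using bergman_holomorphic[OF assms]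
    by (auto simp: bergman_space_def norm_mult power_mult_distrib intro!: holomorphic_intros)
qed

lemma bergman_diff:
  assumes F: "F \<in> bergman_space" and G: "G \<in> bergman_space"
  shows "(\<lambda>z. F z - G z) \<in> bergman_space"
proof -
  have hol: "(\<lambda>z. F z - G z) holomorphic_on upper_half_plane"
    using F G by (intro holomorphic_intros bergman_holomorphic)
  have le: "(cmod (a - b))\<^sup>2 \<le> 2 * (cmod a)\<^sup>2 + 2 * (cmod b)\<^sup>2" for a b
  proof -
    have "(cmod (a - b))\<^sup>2 \<le> (cmod a + cmod b)\<^sup>2"
      by (intro power_mono norm_triangle_ineq4) simp
    also have "\<dots> \<le> 2 * (cmod a)\<^sup>2 + 2 * (cmod b)\<^sup>2"
      using sum_squares_bound[of "cmod a" "cmod b"] by (simp add: power2_sum)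
    finally show ?thesis .
  qed
  have "set_integrable lborel upper_half_plane (\<lambda>z. 2 * (cmod (F z))\<^sup>2 + 2 * (cmod (G z))\<^sup>2)"
    using bergman_integrable[OF F] bergman_integrable[OF G]
    by (intro set_integral_add) auto
  then have "set_integrable lborel upper_half_plane (\<lambda>z. (cmod (F z - G z))\<^sup>2)"
    unfolding set_integrable_def
    by (rule Bochner_Integration.integrable_bound)
       (use holomorphic_norm_square_measurable[OF hol] le in \<open>auto simp: indicator_def\<close>)
  then show ?thesis using hol by (simp add: bergman_space_def)
qed

text \<open>
  Fatou's lemma.
\<close>

lemma bergman_limit:
  assumes F: "\<And>n. F n \<in> bergman_space" and bound: "\<And>n. energy 2 (F n) \<le> B"
    and G: "G holomorphic_on upper_half_plane"
    and lim: "\<And>z. z \<in> upper_half_plane \<Longrightarrow> (\<lambda>n. F n z) \<longlonglongrightarrow> G z"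
  shows "G \<in> bergman_space"
proof -
  define u where "u n z = ennreal (indicator upper_half_plane z *\<^sub>R
     (cmod (F n z) powr 2 * Im z powr (2 - 2)))" for n z
  have meas: "u n \<in> borel_measurable borel" for n
    using energy_density_measurable[OF bergman_holomorphic[OF F], of n 2] by (simp add: u_def[abs_def])
  have "nn_energy 2 G = (\<integral>\<^sup>+z. liminf (\<lambda>n. u n z) \<partial>lborel)"
    unfolding nn_energy_alt
  proof (intro nn_integral_cong)
    fix z :: complex
    have "(\<lambda>n. u n z) \<longlonglongrightarrow> ennreal (indicator upper_half_plane z *\<^sub>R (cmod (G z) powr 2 * Im z powr (2 - 2)))"
      unfolding u_def using lim
      by (cases "z \<in> upper_half_plane") (auto intro!: tendsto_ennrealI tendsto_intros)
    then show "ennreal (indicator upper_half_plane z *\<^sub>R (cmod (G z) powr 2 * Im z powr (2 - 2)))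
        = liminf (\<lambda>n. u n z)"
      using lim_imp_Liminf[of sequentially] by force
  qed
  also have "\<dots> \<le> liminf (\<lambda>n. \<integral>\<^sup>+z. u n z \<partial>lborel)"
    using meas by (intro nn_integral_liminf) simp
  also have "\<dots> \<le> ennreal B"
  proof (rule Liminf_le)
    show "\<forall>\<^sub>F n in sequentially. (\<integral>\<^sup>+z. u n z \<partial>lborel) \<le> ennreal B"
    proof (rule always_eventually, rule allI)
      fix n
      have "(\<integral>\<^sup>+z. u n z \<partial>lborel) = nn_energy 2 (F n)" by (simp add: u_def nn_energy_alt)
      also have "\<dots> \<le> ennreal B" using bound[of n] by (simp add: nn_energy_two_bergman[OF F] ennreal_leI)
      finally show "(\<integral>\<^sup>+z. u n z \<partial>lborel) \<le> ennreal B" .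
    qed
  qed simp
  also have "\<dots> < \<infinity>" by simp
  finally show ?thesis using G by (simp add: bergman_space_iff)
qed

text \<open>
  The weight is moved into the functions, \<open>F \<mapsto> y\<^bsup>(p - 2) / p\<^esup> F\<close>, which turns the energy into an integral
  of a \<open>p\<close>-th power.
\<close>

lemma energy_brezis_lieb:
  assumes p: "p \<ge> 2" and F: "\<And>n. F n \<in> bergman_space" and G: "G \<in> bergman_space"
    and lim: "\<And>z. z \<in> upper_half_plane \<Longrightarrow> (\<lambda>n. F n z) \<longlonglongrightarrow> G z"
    and bound: "\<And>n. energy p (F n) \<le> B"
  shows "(\<lambda>n. energy p (F n) - energy p (\<lambda>z. F n z - G z)) \<longlonglongrightarrow> energy p G"
proof -
  define q where "q = (p - 2) / p"
  define L where "L H z = indicator upper_half_plane z *\<^sub>R (Im z powr q *\<^sub>R H z)" for H :: "complex \<Rightarrow> complex" and z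
  have L_powr: "cmod (L H z) powr p
      = indicator upper_half_plane z *\<^sub>R (cmod (H z) powr p * Im z powr (p - 2))" for H z
  proof (cases "z \<in> upper_half_plane")
    case True
    then have "Im z > 0" by (simp add: upper_half_plane_def)
    then show ?thesis using True p by (simp add: L_def powr_mult powr_powr q_def)
  qed (use p in \<open>simp add: L_def\<close>)
  have energy_L: "energy p H = (LINT z|lborel. cmod (L H z) powr p)" for H
    by (simp add: energy_def set_lebesgue_integral_def L_powr)
  have int_L: "integrable lborel (\<lambda>z. cmod (L H z) powr p)" if "H \<in> bergman_space" for H
    using set_integrable_energy_iff[OF bergman_holomorphic[OF that], of p] nn_energy_bergman[OF that p]
    by (simp add: set_integrable_def L_powr)
  have meas_L: "L H \<in> borel_measurable lborel" if "H \<in> bergman_space" for H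
  proof -
    have "continuous_on upper_half_plane (\<lambda>z. Im z powr q *\<^sub>R H z)"
      using holomorphic_on_imp_continuous_on[OF bergman_holomorphic[OF that]]
      by (intro continuous_intros) (auto simp: upper_half_plane_def)
    then have "(\<lambda>z. indicator upper_half_plane z *\<^sub>R (Im z powr q *\<^sub>R H z)) \<in> borel_measurable borel"
      by (intro borel_measurable_continuous_on_indicator) auto
    then show ?thesis by (simp add: L_def[abs_def])
  qed
  have L_diff: "L (\<lambda>z. F n z - G z) z = L (F n) z - L G z" for n z
    by (simp add: L_def scaleR_diff_right)
  have "(\<lambda>n. (LINT z|lborel. cmod (L (F n) z) powr p) - (LINT z|lborel. cmod (L (F n) z - L G z) powr p))
      \<longlonglongrightarrow> (LINT z|lborel. cmod (L G z) powr p)"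
  proof (rule brezis_lieb[where B = B])
    show "(\<lambda>n. L (F n) z) \<longlonglongrightarrow> L G z" for z
      unfolding L_def using lim[of z] by (cases "z \<in> upper_half_plane") (auto intro!: tendsto_intros)
    show "(LINT z|lborel. cmod (L (F n) z) powr p) \<le> B" for n
      using bound[of n] by (simp add: energy_L)
  qed (use p F G meas_L int_L in auto)
  then show ?thesis by (simp add: energy_L L_diff)
qed

section \<open>Existence of maximizers\<close>

lemma bergman_eq_zero:
  assumes "F \<in> bergman_space" "energy 2 F = 0" "z \<in> upper_half_plane"
  shows "F z = 0"
proof -
  have "4 * pi * (cmod (F z) * Im z)\<^sup>2 \<le> 0"
    using bergman_pointwise_bound[OF assms(1,3)] assms(2) by simp
  then have "(cmod (F z) * Im z)\<^sup>2 \<le> 0" using pi_gt_zero by (simp add: mult_le_0_iff not_le)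
  then show ?thesis using assms(3) by (simp add: upper_half_plane_def)
qed

lemma energy_two_pos:
  assumes "F \<in> bergman_space" "z \<in> upper_half_plane" "F z \<noteq> 0"
  shows "energy 2 F > 0"
  using bergman_eq_zero[OF assms(1) _ assms(2)] assms(3) energy_nonneg[of 2 F] by fastforce

lemma bergman_height_le:
  assumes "F \<in> bergman_space" "energy 2 F = 1" "z \<in> upper_half_plane"
  shows "cmod (F z) * Im z \<le> 1"
proof -
  have "(cmod (F z) * Im z)\<^sup>2 \<le> 4 * pi * (cmod (F z) * Im z)\<^sup>2"
    using pi_gt3 by (intro mult_le_cancel_right1[THEN iffD2]) auto
  also have "\<dots> \<le> 1" using bergman_pointwise_bound[OF assms(1,3)] assms(2) by simp
  finally show ?thesis by (simp add: abs_square_le_1 abs_le_iff)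
qed

lemma sum_powr_less_one:
  fixes m s :: real
  assumes "0 < m" "m < 1" "s > 1"
  shows "m powr s + (1 - m) powr s < 1"
proof -
  have "m powr s < m powr 1" "(1 - m) powr s < (1 - m) powr 1"
    using assms by (intro powr_less_mono'; simp)+
  then show ?thesis using assms by simp
qed

text \<open>
  The limit of a recentred maximizing sequence is a maximizer, since splitting off mass would lose energy:
  the energy scales like the power \<open>p / 2 > 1\<close> of the squared norm, and this power is strictly
  superadditive.
\<close>

lemma energy_maximizer:
  assumes p: "p > 2"
  obtains F where "F \<in> bergman_space" "energy 2 F = 1"
    "\<And>G. G \<in> bergman_space \<Longrightarrow> energy p G \<le> energy p F * energy 2 G powr (p / 2)"
proof -
  (* By homogeneity it suffices to maximize over the unit sphere; A is the supremum there. *)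
  define E where "E = {energy p F | F. F \<in> bergman_space \<and> energy 2 F = 1}"
  define A where "A = Sup E"
  have p2: "p \<ge> 2" using p by simp
  have le_one: "energy p F \<le> 1" if "F \<in> bergman_space" "energy 2 F = 1" for F
    using energy_le_sup[OF that(1) p2, of 1] bergman_height_le[OF that] that(2) by simp
  have bdd: "bdd_above E" using le_one by (auto simp: E_def intro!: bdd_aboveI[of _ 1])
  have normalize: "(\<lambda>z. of_real (1 / sqrt (energy 2 F)) * F z) \<in> bergman_space"
    "energy 2 (\<lambda>z. of_real (1 / sqrt (energy 2 F)) * F z) = 1"
    "energy p (\<lambda>z. of_real (1 / sqrt (energy 2 F)) * F z) = energy p F / energy 2 F powr (p / 2)"
    if F: "F \<in> bergman_space" "energy 2 F > 0" for F
  proof -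
    show "(\<lambda>z. of_real (1 / sqrt (energy 2 F)) * F z) \<in> bergman_space"
      by (rule bergman_scale[OF F(1)])
    have *: "cmod (of_real (1 / sqrt (energy 2 F))) powr q = 1 / energy 2 F powr (q / 2)" for q
    proof -
      have "cmod (of_real (1 / sqrt (energy 2 F))) = energy 2 F powr (- (1 / 2))"
        unfolding norm_of_real using F(2) by (simp add: powr_minus_divide powr_half_sqrt)
      then have "cmod (of_real (1 / sqrt (energy 2 F))) powr q = energy 2 F powr (- (q / 2))"
        by (simp only: powr_powr) simp
      then show ?thesis by (simp only: powr_minus_divide)
    qed
    show "energy 2 (\<lambda>z. of_real (1 / sqrt (energy 2 F)) * F z) = 1"
      using F(2) unfolding energy_scale * by simp
    show "energy p (\<lambda>z. of_real (1 / sqrt (energy 2 F)) * F z) = energy p F / energy 2 F powr (p / 2)"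
      unfolding energy_scale * by simp
  qed
  have le_A: "energy p G \<le> A * energy 2 G powr (p / 2)" if G: "G \<in> bergman_space" for G
  proof (cases "energy 2 G = 0")
    case True
    have "energy p G = 0"
      unfolding energy_def set_lebesgue_integral_def
      using bergman_eq_zero[OF G True]
      by (intro integral_eq_zero_AE AE_I2) (auto simp: indicator_def)
    then show ?thesis using True by simp
  next
    case False
    then have pos: "energy 2 G > 0" using energy_nonneg[of 2 G] by simp
    have "energy p G / energy 2 G powr (p / 2) \<le> A"
      unfolding A_def using normalize[OF G pos]
      by (intro cSup_upper[OF _ bdd]) (auto simp: E_def intro!: exI)
    then show ?thesis using pos by (simp add: field_simps)
  qed
  have A_pos: "A > 0"
  proof -
    have "0 < energy p bergman_kernel_at_i" using p by (simp add: energy_kernel)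
    also have "\<dots> \<le> A * energy 2 bergman_kernel_at_i powr (p / 2)" by (rule le_A[OF kernel_bergman])
    finally show ?thesis by (simp add: zero_less_mult_iff)
  qed
  have ne: "E \<noteq> {}"
    using normalize(1,2)[OF kernel_bergman] by (auto simp: E_def energy_kernel)
  (* A nearly optimal function, recentred so that its height is maximal at i. The last conjunct
     prevents the sequence from vanishing in the limit. *)
  have "\<exists>F. F \<in> bergman_space \<and> energy 2 F = 1 \<and> A - 1 / (real n + 1) < energy p F
      \<and> energy p F \<le> A \<and> energy p F \<le> (cmod (F \<i>)) powr (p - 2)" for n
  proof -
    have "A - 1 / (real n + 1) < Sup E" by (simp add: A_def)
    then obtain F where F: "F \<in> bergman_space" "energy 2 F = 1" "A - 1 / (real n + 1) < energy p F"
      using less_cSup_iff[OF ne bdd] by (auto simp: E_def)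
    obtain w where w: "Im w > 0"
      "\<And>z. z \<in> upper_half_plane \<Longrightarrow> cmod (F z) * Im z \<le> cmod (F w) * Im w"
      using half_plane_height_attains_max[OF F(1)] by blast
    have R: "recentre w F \<in> bergman_space" by (rule recentre_bergman[OF F(1) w(1)])
    have R2: "energy 2 (recentre w F) = 1" using energy_recentre[OF F(1) w(1)] F(2) by simp
    have Rp: "energy p (recentre w F) = energy p F"
      using nn_energy_recentre[OF bergman_holomorphic[OF F(1)] w(1), of p] R F(1) p2 energy_nonneg by (simp add: nn_energy_bergman)
    have "of_real (Re w) + of_real (Im w) * \<i> = w" by (simp add: complex_eq_iff)
    then have Ri: "cmod (recentre w F \<i>) = cmod (F w) * Im w"
      using recentre_height[OF w(1), of F \<i>] by simp
    have "energy p F \<le> (cmod (F w) * Im w) powr (p - 2)"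
      using energy_le_sup[OF F(1) p2 w(2)] F(2) by simp
    moreover have "energy p F \<le> A" using le_A[OF F(1)] F(2) by simp
    ultimately show ?thesis using R R2 Rp Ri F(3) by metis
  qed
  then obtain F where F: "\<And>n. F n \<in> bergman_space" "\<And>n. energy 2 (F n) = 1"
    "\<And>n. A - 1 / (real n + 1) < energy p (F n)" "\<And>n. energy p (F n) \<le> A"
    "\<And>n. energy p (F n) \<le> (cmod (F n \<i>)) powr (p - 2)"
    by metis
  have unif: "\<exists>B. \<forall>h\<in>range F. \<forall>z\<in>K. cmod (h z) \<le> B" if K: "compact K" "K \<subseteq> upper_half_plane" for K
  proof -
    have "compact ((\<lambda>z. 1 / Im z) ` K)"
      using K by (intro compact_continuous_image continuous_intros) (auto simp: upper_half_plane_def)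
    then obtain B where B: "\<And>z. z \<in> K \<Longrightarrow> 1 / Im z \<le> B"
      using compact_imp_bounded bounded_imp_bdd_above unfolding bdd_above_def by (metis imageI)
    have "cmod (F n z) \<le> B" if z: "z \<in> K" for n z
    proof -
      have "z \<in> upper_half_plane" using z K by auto
      from bergman_height_le[OF F(1,2) this] have "cmod (F n z) \<le> 1 / Im z"
        using \<open>z \<in> upper_half_plane\<close> by (simp add: upper_half_plane_def field_simps)
      then show ?thesis using B[OF z] by simp
    qed
    then show ?thesis by blast
  qed
  have hol: "h holomorphic_on upper_half_plane" if "h \<in> range F" for h
    using that F(1) bergman_holomorphic by auto
  obtain g r where g: "g holomorphic_on upper_half_plane" "strict_mono (r :: nat \<Rightarrow> nat)"
    "\<And>z. z \<in> upper_half_plane \<Longrightarrow> (\<lambda>n. F (r n) z) \<longlonglongrightarrow> g z"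
    "\<And>K. compact K \<Longrightarrow> K \<subseteq> upper_half_plane \<Longrightarrow> uniform_limit K (F \<circ> r) g sequentially"
    by (rule Montel[OF open_upper_half_plane hol unif subset_refl], assumption, assumption, assumption)
       (rule that; blast)
  define H where "H n = F (r n)" for n
  have H: "H n \<in> bergman_space" "energy 2 (H n) = 1" "energy p (H n) \<le> A" for n
    using F by (simp_all add: H_def)
  have H_lim: "\<And>z. z \<in> upper_half_plane \<Longrightarrow> (\<lambda>n. H n z) \<longlonglongrightarrow> g z"
    using g(3) by (simp add: H_def)
  have g_bergman: "g \<in> bergman_space"
    by (rule bergman_limit[of H 1]) (use H H_lim g(1) in auto)
  have energy_H: "(\<lambda>n. energy p (H n)) \<longlonglongrightarrow> A"
  proof (rule tendsto_sandwich)
    have "(\<lambda>n. A - 1 / (real n + 1)) \<longlonglongrightarrow> A - 0"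
      by (intro tendsto_intros LIMSEQ_inverse_real_of_nat[unfolded inverse_eq_divide of_nat_Suc add.commute[of 1]])
    then show "(\<lambda>n. A - 1 / (real n + 1)) \<longlonglongrightarrow> A" by simp
    show "\<forall>\<^sub>F n in sequentially. A - 1 / (real n + 1) \<le> energy p (H n)"
    proof (intro always_eventually allI)
      fix n
      have "n \<le> r n" using g(2) by (rule seq_suble)
      then have "1 / (real (r n) + 1) \<le> 1 / (real n + 1)" by (intro divide_left_mono) auto
      then show "A - 1 / (real n + 1) \<le> energy p (H n)" using F(3)[of "r n"] by (simp add: H_def)
    qed
    show "\<forall>\<^sub>F n in sequentially. energy p (H n) \<le> A" using H(3) by simp
  qed simp
  have "\<i> \<in> upper_half_plane" by (simp add: upper_half_plane_def)
  have "A \<le> cmod (g \<i>) powr (p - 2)"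
  proof (rule LIMSEQ_le[OF energy_H])
    show "(\<lambda>n. cmod (H n \<i>) powr (p - 2)) \<longlonglongrightarrow> cmod (g \<i>) powr (p - 2)"
      using p H_lim[OF \<open>\<i> \<in> upper_half_plane\<close>] by (intro tendsto_powr' tendsto_norm tendsto_const) auto
    show "\<exists>N. \<forall>n\<ge>N. energy p (H n) \<le> cmod (H n \<i>) powr (p - 2)" using F(5) by (auto simp: H_def)
  qed
  then have "g \<i> \<noteq> 0" using A_pos by auto
  (* m is the share of the squared norm that the limit retains; d carries the share that escapes. *)
  define m where "m = energy 2 g"
  have m_pos: "m > 0"
    unfolding m_def by (rule energy_two_pos[OF g_bergman \<open>\<i> \<in> upper_half_plane\<close> \<open>g \<i> \<noteq> 0\<close>])
  define d where "d n z = H n z - g z" for n z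
  have d: "d n \<in> bergman_space" for n
    unfolding d_def by (rule bergman_diff[OF H(1) g_bergman])
  have "(\<lambda>n. energy 2 (H n) - energy 2 (d n)) \<longlonglongrightarrow> m"
    unfolding d_def m_def by (rule energy_brezis_lieb[OF _ H(1) g_bergman H_lim, of _ 1]) (use H in auto)
  then have "(\<lambda>n. 1 - (1 - energy 2 (d n))) \<longlonglongrightarrow> 1 - m"
    using H(2) by (intro tendsto_intros) simp
  then have d2: "(\<lambda>n. energy 2 (d n)) \<longlonglongrightarrow> 1 - m" by simp
  have m_le: "m \<le> 1"
    using LIMSEQ_le_const[OF d2, of 0] energy_nonneg by auto
  have "(\<lambda>n. energy p (H n) - energy p (d n)) \<longlonglongrightarrow> energy p g"
    unfolding d_def by (rule energy_brezis_lieb[OF p2 H(1) g_bergman H_lim, of A]) (use H in auto)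
  from tendsto_diff[OF energy_H this] have dp: "(\<lambda>n. energy p (d n)) \<longlonglongrightarrow> A - energy p g" by simp
  have "A - energy p g \<le> A * (1 - m) powr (p / 2)"
  proof (rule LIMSEQ_le[OF dp])
    show "(\<lambda>n. A * energy 2 (d n) powr (p / 2)) \<longlonglongrightarrow> A * (1 - m) powr (p / 2)"
      using p m_le energy_nonneg by (intro tendsto_intros tendsto_powr' d2) auto
    show "\<exists>N. \<forall>n\<ge>N. energy p (d n) \<le> A * energy 2 (d n) powr (p / 2)" using le_A[OF d] by auto
  qed
  moreover have gp: "energy p g \<le> A * m powr (p / 2)" using le_A[OF g_bergman] by (simp add: m_def)
  ultimately have ineq: "A * 1 \<le> A * (m powr (p / 2) + (1 - m) powr (p / 2))"
    by (simp add: algebra_simps)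
  have m1: "m = 1"
  proof (rule ccontr)
    assume "m \<noteq> 1"
    then have "m powr (p / 2) + (1 - m) powr (p / 2) < 1"
      using m_pos m_le p by (intro sum_powr_less_one) auto
    then show False using ineq A_pos by simp
  qed
  have "A = energy p g" using \<open>A - energy p g \<le> A * (1 - m) powr (p / 2)\<close> gp by (simp add: m1)
  then show thesis using that[OF g_bergman] le_A m1 by (simp add: m_def)
qed

section \<open>Concentrated functions\<close>

text \<open>
  By the maximum principle for \<open>h z / z\<^sup>2\<close> on the disc of radius \<open>1 / 2\<close>, where the hypothesis bounds \<open>|h|\<close> by
  \<open>2 e\<close>; outside that disc \<open>|z|\<^sup>2 \<ge> 1 / 4\<close> and the hypothesis suffices.
\<close>

lemma second_order_schwarz:
  assumes hol: "h holomorphic_on ball 0 1" and h0: "h 0 = 0" and h'0: "deriv h 0 = 0"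
    and bound: "\<And>z. z \<in> ball 0 1 \<Longrightarrow> cmod (h z) * (1 - cmod z) \<le> e"
    and z: "z \<in> ball 0 1"
  shows "cmod (h z) * (1 - (cmod z)\<^sup>2) \<le> 8 * e * (cmod z)\<^sup>2"
proof -
  obtain h1 where h1: "h1 holomorphic_on ball 0 1" "\<And>z. cmod z < 1 \<Longrightarrow> h z = z * h1 z" "deriv h 0 = h1 0"
    using Schwarz3[OF hol h0] by blast
  have "h1 0 = 0" using h1(3) h'0 by simp
  then obtain h2 where h2: "h2 holomorphic_on ball 0 1" "\<And>z. cmod z < 1 \<Longrightarrow> h1 z = z * h2 z"
    using Schwarz3[OF h1(1)] by blast
  have h_eq: "h z = z\<^sup>2 * h2 z" if "cmod z < 1" for z
    using h1(2) h2(2) that by (simp add: power2_eq_square)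
  have z1: "cmod z < 1" using z by simp
  have "e \<ge> 0" using bound[of 0] h0 by simp
  show ?thesis
  proof (cases "cmod z < 1 / 2")
    case True
    have "cmod (h2 z) \<le> 8 * e"
    proof (rule maximum_modulus_frontier[of h2 "ball 0 (1/2)"])
      show "h2 holomorphic_on interior (ball 0 (1/2))"
        using holomorphic_on_subset[OF h2(1)] by (simp add: subset_ball)
      show "continuous_on (closure (ball 0 (1/2))) h2"
        by (rule continuous_on_subset[OF holomorphic_on_imp_continuous_on[OF h2(1)]]) auto
      show "cmod (h2 w) \<le> 8 * e" if "w \<in> frontier (ball 0 (1/2))" for w
      proof -
        have w: "cmod w = 1 / 2" using that by (simp add: frontier_ball)
        have "cmod (h w) = (cmod w)\<^sup>2 * cmod (h2 w)" using h_eq[of w] w by (simp add: norm_mult norm_power)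
        then have "cmod (h w) = cmod (h2 w) / 4" unfolding w by (simp add: power_divide)
        then show ?thesis using bound[of w] w by simp
      qed
    qed (use True in auto)
    moreover have "cmod (h z) * (1 - (cmod z)\<^sup>2) \<le> cmod (h z) * 1"
      by (intro mult_left_mono) auto
    moreover have "cmod (h z) = cmod (h2 z) * (cmod z)\<^sup>2" using h_eq[OF z1] by (simp add: norm_mult norm_power)
    ultimately show ?thesis
      using mult_right_mono[of "cmod (h2 z)" "8 * e" "(cmod z)\<^sup>2"] by simp
  next
    case False
    have "cmod (h z) * (1 - (cmod z)\<^sup>2) = (cmod (h z) * (1 - cmod z)) * (1 + cmod z)"
      by (simp add: power2_eq_square algebra_simps)
    also have "\<dots> \<le> e * 2" using bound[OF z] z1 \<open>e \<ge> 0\<close> by (intro mult_mono) auto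
    also have "\<dots> \<le> 8 * e * (cmod z)\<^sup>2"
    proof -
      have "(1 / 2)\<^sup>2 \<le> (cmod z)\<^sup>2" using False by (intro power_mono) auto
      then have "8 * e * (1 / 2)\<^sup>2 \<le> 8 * e * (cmod z)\<^sup>2" using \<open>e \<ge> 0\<close> by (intro mult_left_mono) auto
      then show ?thesis by (simp add: power2_eq_square)
    qed
    finally show ?thesis .
  qed
qed

text \<open>
  The factor \<open>1 - |w|\<^sup>2\<close> is stationary at \<open>0\<close>. So a nonzero derivative of \<open>f\<close> would give a
  direction \<open>\<zeta>\<close> along which the height has positive derivative at \<open>0\<close>.
\<close>

lemma deriv_zero_at_height_max:
  assumes hol: "f holomorphic_on ball 0 1" and f0: "f 0 \<noteq> 0"
    and max: "\<And>w. w \<in> ball 0 1 \<Longrightarrow> cmod (f w) * (1 - (cmod w)\<^sup>2) \<le> cmod (f 0)"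
  shows "deriv f 0 = 0"
proof (rule ccontr)
  assume "deriv f 0 \<noteq> 0"
  define c where "c = deriv f 0 / f 0"
  have c: "c \<noteq> 0" using \<open>deriv f 0 \<noteq> 0\<close> f0 by (simp add: c_def)
  (* the direction of steepest ascent of Re (f / f 0) *)
  define \<zeta> where "\<zeta> = cnj c / of_real (cmod c)"
  have \<zeta>: "cmod \<zeta> = 1" "c * \<zeta> = of_real (cmod c)"
    using c by (simp_all add: \<zeta>_def norm_divide complex_norm_square[symmetric] power2_eq_square)
  define g where "g x = f (x * \<zeta>) / f 0" for x
  have "(f has_field_derivative deriv f 0) (at 0)"
    using hol by (intro holomorphic_derivI[of f "ball 0 1"]) auto
  then have f': "(f has_field_derivative deriv f 0) (at (0 * \<zeta>))" by simp
  have "(g has_field_derivative of_real (cmod c)) (at 0)"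
    unfolding g_def using f0 \<zeta>(2)
    by (auto intro!: derivative_eq_intros DERIV_chain2[where g = "\<lambda>x. x * \<zeta>" and x = 0, OF f'] simp: c_def)
  then have "(g has_field_derivative of_real (cmod c)) (at (of_real 0))" by simp
  then have "((\<lambda>t. g (of_real t)) has_vector_derivative of_real (cmod c)) (at 0)"
    by (rule has_vector_derivative_real_field)
  from bounded_linear.has_vector_derivative[OF bounded_linear_Re this]
  have dRe: "((\<lambda>t. Re (g (of_real t))) has_real_derivative cmod c) (at 0)"
    by (simp add: has_real_derivative_iff_has_vector_derivative)
  have g0: "g 0 = 1" using f0 by (simp add: g_def)
  have "((\<lambda>t::real. 1 - t\<^sup>2) has_real_derivative 0) (at 0)"
    by (auto intro!: derivative_eq_intros)
  from DERIV_mult'[OF dRe this]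
  have "((\<lambda>t. Re (g (of_real t)) * (1 - t\<^sup>2)) has_real_derivative cmod c) (at 0)" by simp
  then have "cmod c = 0"
  proof (rule DERIV_local_max)
    show "\<forall>t. \<bar>0 - t\<bar> < 1 \<longrightarrow> Re (g (of_real t)) * (1 - t\<^sup>2) \<le> Re (g (of_real 0)) * (1 - 0\<^sup>2)"
    proof (intro allI impI)
      fix t :: real assume t: "\<bar>0 - t\<bar> < 1"
      then have "t\<^sup>2 < 1" by (simp add: abs_square_less_1)
      have n: "cmod (of_real t * \<zeta>) = \<bar>t\<bar>" using \<zeta>(1) by (simp add: norm_mult)
      have "Re (g (of_real t)) * (1 - t\<^sup>2) \<le> cmod (g (of_real t)) * (1 - t\<^sup>2)"
        using \<open>t\<^sup>2 < 1\<close> by (intro mult_right_mono complex_Re_le_cmod) auto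
      also have "\<dots> = cmod (f (of_real t * \<zeta>)) * (1 - (cmod (of_real t * \<zeta>))\<^sup>2) / cmod (f 0)"
        unfolding n by (simp add: g_def norm_divide)
      also have "\<dots> \<le> 1"
        using max[of "of_real t * \<zeta>"] n t f0 by simp
      finally show "Re (g (of_real t)) * (1 - t\<^sup>2) \<le> Re (g (of_real 0)) * (1 - 0\<^sup>2)"
        using g0 by simp
    qed
  qed simp
  then show False using c by simp
qed

text \<open>
  Pythagoras: by the mean value property \<open>f - f 0\<close> is orthogonal to the constants, whose squared norm is \<open>\<pi>\<close> times
  the square of their modulus.
\<close>

lemma disc_variance:
  assumes hol: "f holomorphic_on ball 0 1"
    and int: "set_integrable lborel (ball 0 1) (\<lambda>w. (cmod (f w))\<^sup>2)"
  shows "set_integrable lborel (ball 0 1) (\<lambda>w. (cmod (f w - f 0))\<^sup>2)"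
    and "(LINT w:ball 0 1|lborel. (cmod (f w - f 0))\<^sup>2)
        = (LINT w:ball 0 1|lborel. (cmod (f w))\<^sup>2) - pi * (cmod (f 0))\<^sup>2"
proof -
  have const: "set_integrable lborel (ball (0::complex) 1) (\<lambda>w. k)" for k :: "'a::{banach,second_countable_topology}"
    unfolding set_integrable_def by (intro integrable_scaleR_left) (simp add: emeasure_ball)
  have contf: "continuous_on (ball 0 1) f"
    using hol by (rule holomorphic_on_imp_continuous_on)
  have measf: "(\<lambda>w. indicator (ball 0 1) w *\<^sub>R f w) \<in> borel_measurable borel"
    using contf by (intro borel_measurable_continuous_on_indicator) auto
  have "set_integrable lborel (ball 0 1) (\<lambda>w. 1 + (cmod (f w))\<^sup>2)"
    using const[of "1::real"] int by (rule set_integral_add)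
  then have intf: "set_integrable lborel (ball 0 1) f"
    unfolding set_integrable_def
  proof (rule Bochner_Integration.integrable_bound)
    show "(\<lambda>w. indicator (ball 0 1) w *\<^sub>R f w) \<in> borel_measurable lborel" using measf by simp
    have "x \<le> 1 + x\<^sup>2" if "0 \<le> x" for x :: real
      using sum_squares_bound[of x 1] that by simp
    then show "AE w in lborel. norm (indicator (ball 0 1) w *\<^sub>R f w)
        \<le> norm (indicator (ball 0 1) w *\<^sub>R (1 + (cmod (f w))\<^sup>2))"
      by (intro AE_I2) (auto simp: indicator_def)
  qed
  define R where "R w = Re (cnj (f 0) * f w)" for w
  have eq: "(cmod (f w - f 0))\<^sup>2 = (cmod (f w))\<^sup>2 - 2 * R w + (cmod (f 0))\<^sup>2" for w
    unfolding cmod_power2 R_def by (simp add: power2_eq_square algebra_simps)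
  have hb: "has_bochner_integral lborel (\<lambda>w. indicator (ball 0 1) w *\<^sub>R f w) (of_real pi * f 0)"
    using intf disc_mean_value[OF hol zero_less_one intf]
    by (simp add: has_bochner_integral_iff set_integrable_def set_lebesgue_integral_def)
  have "has_bochner_integral lborel (\<lambda>w. Re (cnj (f 0) * (indicator (ball 0 1) w *\<^sub>R f w)))
      (Re (cnj (f 0) * (of_real pi * f 0)))"
    by (intro has_bochner_integral_bounded_linear[OF bounded_linear_Re] has_bochner_integral_mult_right hb)
  moreover have "Re (cnj (f 0) * (of_real pi * f 0)) = pi * (cmod (f 0))\<^sup>2"
    unfolding cmod_power2 by (simp add: power2_eq_square algebra_simps)
  moreover have "(\<lambda>w. Re (cnj (f 0) * (indicator (ball 0 1) w *\<^sub>R f w))) = (\<lambda>w. indicator (ball 0 1) w *\<^sub>R R w)"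
    by (simp add: R_def fun_eq_iff algebra_simps)
  ultimately have "has_bochner_integral lborel (\<lambda>w. indicator (ball 0 1) w *\<^sub>R R w) (pi * (cmod (f 0))\<^sup>2)"
    by metis
  then have R: "set_integrable lborel (ball 0 1) R" "(LINT w:ball 0 1|lborel. R w) = pi * (cmod (f 0))\<^sup>2"
    by (simp_all add: has_bochner_integral_iff set_integrable_def set_lebesgue_integral_def)
  have i1: "set_integrable lborel (ball 0 1) (\<lambda>w. (cmod (f w))\<^sup>2 - 2 * R w)"
    using int R(1) by (intro set_integral_diff) auto
  show "set_integrable lborel (ball 0 1) (\<lambda>w. (cmod (f w - f 0))\<^sup>2)"
    unfolding eq by (intro set_integral_add i1 const)
  have c: "(LINT w:ball (0::complex) 1|lborel. (cmod (f 0))\<^sup>2) = pi * (cmod (f 0))\<^sup>2"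
    using content_ball[of 1 "0::complex"]
    by (simp add: set_lebesgue_integral_def unit_ball_vol_2)
  show "(LINT w:ball 0 1|lborel. (cmod (f w - f 0))\<^sup>2)
        = (LINT w:ball 0 1|lborel. (cmod (f w))\<^sup>2) - pi * (cmod (f 0))\<^sup>2"
    unfolding eq
    by (subst set_integral_add, rule i1, rule const, subst set_integral_diff)
       (use int R c in auto)
qed

lemma nn_integral_linear_powr_le:
  assumes \<kappa>: "0 < \<kappa>" "\<kappa> < 1" and p: "p > 0"
  shows "(\<integral>\<^sup>+t\<in>{0..1}. ennreal ((\<kappa> + (1 - \<kappa>) * t) powr p) \<partial>lborel) \<le> ennreal (1 / ((p + 1) * (1 - \<kappa>)))"
proof -
  define G where "G t = (\<kappa> + (1 - \<kappa>) * t) powr (p + 1) / ((p + 1) * (1 - \<kappa>))" for t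
  have pos: "\<kappa> + (1 - \<kappa>) * t > 0" if "0 \<le> t" for t
    using \<kappa> that by (intro add_pos_nonneg mult_nonneg_nonneg) auto
  have "(\<integral>\<^sup>+t. ennreal ((\<kappa> + (1 - \<kappa>) * t) powr p) * indicator {0..1} t \<partial>lborel) = ennreal (G 1 - G 0)"
  proof (rule nn_integral_FTC_Icc)
    fix t :: real assume "t \<in> {0..1}"
    then have "\<kappa> + (1 - \<kappa>) * t > 0" using pos by simp
    then show "DERIV G t :> (\<kappa> + (1 - \<kappa>) * t) powr p"
      unfolding G_def using \<kappa> p
      by (auto intro!: derivative_eq_intros simp: powr_diff)
  qed auto
  also have "\<dots> \<le> ennreal (1 / ((p + 1) * (1 - \<kappa>)))"
    using \<kappa> p by (intro ennreal_leI) (simp add: G_def)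
  finally show ?thesis .
qed

text \<open>
  If almost all of the norm of \<open>F\<close> sits in the kernel at \<open>\<i>\<close> and the height is maximal there, then the energy
  exceeds that of the kernel only slightly. On the disc, the height \<open>|f| (1 - |w|\<^sup>2)\<close> lies below
  \<open>1 - (1 - \<kappa>) |w|\<^sup>2\<close>. Hyperbolic area blows up at the boundary, so the bound is used for all \<open>p\<close> factors
  only where \<open>|w|\<^sup>2 \<le> \<eta>\<close>; elsewhere it is used for \<open>p - 2\<close> factors, and \<open>\<integral> |f|\<^sup>2 = \<pi>\<close> takes care of
  the rest.
\<close>

lemma energy_le_of_concentrated:
  assumes F: "F \<in> bergman_space" "energy 2 F = pi" and Fi: "F \<i> \<noteq> 0"
    and max: "\<And>z. z \<in> upper_half_plane \<Longrightarrow> cmod (F z) * Im z \<le> cmod (F \<i>)"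
    and \<kappa>: "0 < \<kappa>" "\<kappa> < 1" "8 * sqrt (1 - (2 * cmod (F \<i>))\<^sup>2) \<le> \<kappa>"
    and \<eta>: "0 < \<eta>" "\<eta> < 1" and p: "p \<ge> 2"
  shows "energy p F \<le> 2 powr (2 - p) * pi *
    (1 / ((p + 1) * (1 - \<kappa>) * (1 - \<eta>)\<^sup>2) + (1 - (1 - \<kappa>) * \<eta>) powr (p - 2))"
proof -
  define f where "f = to_disc F"
  define a where "a = cmod (f 0)"
  have hol: "f holomorphic_on ball 0 1"
    unfolding f_def by (rule to_disc_holomorphic[OF bergman_holomorphic[OF F(1)]])
  have int: "set_integrable lborel (ball 0 1) (\<lambda>w. (cmod (f w))\<^sup>2)"
    and norm: "(LINT w:ball 0 1|lborel. (cmod (f w))\<^sup>2) = pi"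
    using to_disc_norm[OF F(1)] F(2) by (simp_all add: f_def)
  have a_eq: "a = 2 * cmod (F \<i>)"
    by (simp add: a_def f_def to_disc_def deriv_cayley norm_mult) (simp add: cayley_def)
  have f0: "f 0 \<noteq> 0" using a_eq Fi by (auto simp: a_def)
  have height: "cmod (f w) * (1 - (cmod w)\<^sup>2) \<le> a" if w: "w \<in> ball 0 1" for w
  proof -
    have "cayley w \<in> upper_half_plane" using w cayley_image by blast
    from max[OF this] show ?thesis using to_disc_height[OF w, of F] a_eq by (simp add: f_def)
  qed
  have a1: "a \<le> 1"
  proof -
    have "pi * 1\<^sup>2 * a\<^sup>2 \<le> pi"
      using norm_square_le_disc_mean[OF hol zero_less_one int] norm by (simp add: a_def)
    then show ?thesis by (simp add: abs_square_le_1)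
  qed
  define h where "h w = f w - f 0" for w
  (* norm of the remainder h, up to the factor sqrt pi *)
  define e where "e = sqrt (1 - a\<^sup>2)"
  have e: "e\<^sup>2 = 1 - a\<^sup>2" "e \<ge> 0"
    using a1 by (simp_all add: e_def a_def abs_square_le_1)
  have holh: "h holomorphic_on ball 0 1" unfolding h_def using hol by (intro holomorphic_intros)
  have inth: "set_integrable lborel (ball 0 1) (\<lambda>w. (cmod (h w))\<^sup>2)"
    and normh: "(LINT w:ball 0 1|lborel. (cmod (h w))\<^sup>2) = pi * e\<^sup>2"
    using disc_variance[OF hol int] norm by (simp_all add: h_def e a_def algebra_simps)
  have h_bound: "cmod (h z) * (1 - cmod z) \<le> e" if z: "z \<in> ball 0 1" for z
  proof -
    have R: "1 - cmod z > 0" using z by simp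
    have sub: "ball z (1 - cmod z) \<subseteq> ball 0 1"
    proof
      fix x assume "x \<in> ball z (1 - cmod z)"
      then have "cmod (x - z) < 1 - cmod z" by (simp add: dist_norm norm_minus_commute)
      then show "x \<in> ball 0 1" using norm_triangle_ineq[of z "x - z"] by simp
    qed
    have ints: "set_integrable lborel (ball z (1 - cmod z)) (\<lambda>w. (cmod (h w))\<^sup>2)"
      by (rule set_integrable_subset[OF inth _ sub]) simp
    have "pi * (1 - cmod z)\<^sup>2 * (cmod (h z))\<^sup>2 \<le> (LINT w:ball z (1 - cmod z)|lborel. (cmod (h w))\<^sup>2)"
      by (rule norm_square_le_disc_mean[OF holomorphic_on_subset[OF holh sub] R ints])
    also have "\<dots> \<le> (LINT w:ball 0 1|lborel. (cmod (h w))\<^sup>2)"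
      unfolding set_lebesgue_integral_def
      by (rule integral_mono[OF ints[unfolded set_integrable_def] inth[unfolded set_integrable_def]])
         (use sub in \<open>auto simp: indicator_def\<close>)
    finally have "(cmod (h z) * (1 - cmod z))\<^sup>2 \<le> e\<^sup>2"
      unfolding normh by (simp add: power_mult_distrib mult.commute mult.left_commute)
    then show ?thesis using e(2) by (rule power2_le_imp_le)
  qed
  have "deriv h 0 = deriv f 0"
  proof -
    have "(f has_field_derivative deriv f 0) (at 0)"
      using hol by (intro holomorphic_derivI[of f "ball 0 1"]) auto
    then have "(h has_field_derivative deriv f 0) (at 0)"
      unfolding h_def by (auto intro!: derivative_eq_intros)
    then show ?thesis by (rule DERIV_imp_deriv)
  qed
  also have "deriv f 0 = 0"
    by (rule deriv_zero_at_height_max[OF hol f0]) (use height in \<open>simp add: a_def\<close>)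
  finally have h'0: "deriv h 0 = 0" .
  have \<kappa>e: "8 * e \<le> \<kappa>" using \<kappa>(3) by (simp add: e_def a_eq)
  (* The constant part contributes at most 1 - r and the remainder at most kappa r. *)
  have decay: "cmod (f w) * (1 - (cmod w)\<^sup>2) \<le> 1 - (1 - \<kappa>) * (cmod w)\<^sup>2" if w: "w \<in> ball 0 1" for w
  proof -
    have r: "1 - (cmod w)\<^sup>2 \<ge> 0" using w by (simp add: abs_square_le_1)
    have "cmod (f w) \<le> a + cmod (h w)"
      using norm_triangle_ineq[of "f 0" "h w"] by (simp add: h_def a_def)
    then have "cmod (f w) * (1 - (cmod w)\<^sup>2) \<le> (a + cmod (h w)) * (1 - (cmod w)\<^sup>2)"
      using r by (rule mult_right_mono)
    also have "\<dots> = a * (1 - (cmod w)\<^sup>2) + cmod (h w) * (1 - (cmod w)\<^sup>2)" by (rule distrib_right)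
    also have "\<dots> \<le> 1 * (1 - (cmod w)\<^sup>2) + \<kappa> * (cmod w)\<^sup>2"
    proof (rule add_mono)
      show "a * (1 - (cmod w)\<^sup>2) \<le> 1 * (1 - (cmod w)\<^sup>2)" using a1 r by (rule mult_right_mono)
      have "cmod (h w) * (1 - (cmod w)\<^sup>2) \<le> 8 * e * (cmod w)\<^sup>2"
        by (rule second_order_schwarz[OF holh _ h'0 h_bound w]) (simp_all add: h_def)
      also have "\<dots> \<le> \<kappa> * (cmod w)\<^sup>2" using \<kappa>e by (rule mult_right_mono) simp
      finally show "cmod (h w) * (1 - (cmod w)\<^sup>2) \<le> \<kappa> * (cmod w)\<^sup>2" .
    qed
    finally show ?thesis by (simp add: algebra_simps)
  qed
  define Q where "Q = (1 - (1 - \<kappa>) * \<eta>) powr (p - 2)"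
  define L where "L t = (\<kappa> + (1 - \<kappa>) * t) powr p" for t :: real
  have pointwise: "cmod (f w) powr p * ((1 - (cmod w)\<^sup>2) / 2) powr (p - 2)
      \<le> 2 powr (2 - p) * (1 / (1 - \<eta>)\<^sup>2 * L (1 - (cmod w)\<^sup>2) + Q * (cmod (f w))\<^sup>2)"
    if w: "w \<in> ball 0 1" for w
  proof -
    define r where "r = (cmod w)\<^sup>2"
    have r: "0 \<le> r" "r < 1" using w by (simp_all add: r_def abs_square_less_1)
    have dec: "cmod (f w) * (1 - r) \<le> 1 - (1 - \<kappa>) * r" using decay[OF w] by (simp add: r_def)
    have half: "((1 - r) / 2) powr (p - 2) = 2 powr (2 - p) * (1 - r) powr (p - 2)"
      using r by (simp add: powr_divide powr_minus_divide[of 2 "p - 2", simplified])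
    have "cmod (f w) powr p * (1 - r) powr (p - 2)
        \<le> 1 / (1 - \<eta>)\<^sup>2 * L (1 - r) + Q * (cmod (f w))\<^sup>2"
    proof (cases "r \<le> \<eta>")
      case True
      have "cmod (f w) powr p * (1 - r) powr (p - 2) = (cmod (f w) * (1 - r)) powr p / (1 - r)\<^sup>2"
        using r by (simp add: powr_mult powr_diff)
      also have "\<dots> \<le> (1 - (1 - \<kappa>) * r) powr p / (1 - \<eta>)\<^sup>2"
        using True r \<eta> dec p by (intro frac_le powr_mono2 power_mono) auto
      also have "\<dots> = 1 / (1 - \<eta>)\<^sup>2 * L (1 - r)" by (simp add: L_def algebra_simps)
      also have "\<dots> \<le> 1 / (1 - \<eta>)\<^sup>2 * L (1 - r) + Q * (cmod (f w))\<^sup>2" by (simp add: Q_def)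
      finally show ?thesis .
    next
      case False
      have "cmod (f w) powr p = cmod (f w) powr (p - 2) * cmod (f w) powr 2"
        by (simp only: powr_add[symmetric]) simp
      then have "cmod (f w) powr p * (1 - r) powr (p - 2) = (cmod (f w) * (1 - r)) powr (p - 2) * (cmod (f w))\<^sup>2"
        using r by (simp add: powr_mult)
      also have "\<dots> \<le> Q * (cmod (f w))\<^sup>2"
      proof (rule mult_right_mono)
        have "(1 - \<kappa>) * \<eta> \<le> (1 - \<kappa>) * r" using False \<kappa> by (intro mult_left_mono) auto
        then have "cmod (f w) * (1 - r) \<le> 1 - (1 - \<kappa>) * \<eta>" using dec by linarith
        then show "(cmod (f w) * (1 - r)) powr (p - 2) \<le> Q"
          unfolding Q_def using r p by (intro powr_mono2) auto
      qed simp
      also have "\<dots> \<le> 1 / (1 - \<eta>)\<^sup>2 * L (1 - r) + Q * (cmod (f w))\<^sup>2" by (simp add: L_def)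
      finally show ?thesis .
    qed
    then have "2 powr (2 - p) * (cmod (f w) powr p * (1 - r) powr (p - 2))
        \<le> 2 powr (2 - p) * (1 / (1 - \<eta>)\<^sup>2 * L (1 - r) + Q * (cmod (f w))\<^sup>2)"
      by (rule mult_left_mono) simp
    then show ?thesis unfolding r_def[symmetric] half by (simp add: mult_ac)
  qed
  have Lmeas [measurable]: "(\<lambda>t. ennreal (L t)) \<in> borel_measurable borel"
    unfolding L_def by measurable
  have meas2: "(\<lambda>w. ennreal ((cmod (f w))\<^sup>2) * indicator (ball 0 1) w) \<in> borel_measurable borel"
  proof -
    have "(\<lambda>w. ennreal (indicator (ball 0 1) w *\<^sub>R (cmod (f w))\<^sup>2)) \<in> borel_measurable borel"
      using holomorphic_norm_square_measurable[OF hol] by simp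
    also have "(\<lambda>w. ennreal (indicator (ball 0 1) w *\<^sub>R (cmod (f w))\<^sup>2))
        = (\<lambda>w. ennreal ((cmod (f w))\<^sup>2) * indicator (ball 0 1) w)"
      by (auto simp: fun_eq_iff indicator_def)
    finally show ?thesis .
  qed
  have meas1: "(\<lambda>w. ennreal (L (1 - (cmod w)\<^sup>2)) * indicator (ball 0 1) w) \<in> borel_measurable borel"
  proof -
    have [measurable]: "(indicator (ball (0::complex) 1) :: complex \<Rightarrow> ennreal) \<in> borel_measurable borel"
      by (intro borel_measurable_indicator) auto
    show ?thesis by measurable
  qed
  have Q0: "Q \<ge> 0" by (simp add: Q_def)
  have I1: "(\<integral>\<^sup>+w\<in>ball (0::complex) 1. ennreal (L (1 - (cmod w)\<^sup>2)) \<partial>lborel) \<le> ennreal (pi / ((p + 1) * (1 - \<kappa>)))"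
  proof -
    have "(\<integral>\<^sup>+w\<in>ball (0::complex) 1. ennreal (L (1 - (cmod w)\<^sup>2)) \<partial>lborel)
        = ennreal pi * (\<integral>\<^sup>+t\<in>{0..1}. ennreal (L t) \<partial>lborel)"
      by (rule nn_integral_disc_radial) measurable
    also have "\<dots> \<le> ennreal pi * ennreal (1 / ((p + 1) * (1 - \<kappa>)))"
      unfolding L_def using \<kappa> p by (intro mult_left_mono nn_integral_linear_powr_le) auto
    also have "\<dots> = ennreal (pi / ((p + 1) * (1 - \<kappa>)))"
      using \<kappa> p by (simp add: ennreal_mult'[symmetric])
    finally show ?thesis .
  qed
  have I2: "(\<integral>\<^sup>+w\<in>ball 0 1. ennreal ((cmod (f w))\<^sup>2) \<partial>lborel) = ennreal pi"
  proof -
    have "(\<integral>\<^sup>+w\<in>ball 0 1. ennreal ((cmod (f w))\<^sup>2) \<partial>lborel)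
        = (\<integral>\<^sup>+w. ennreal (indicator (ball 0 1) w *\<^sub>R (cmod (f w))\<^sup>2) \<partial>lborel)"
      by (intro nn_integral_cong) (auto simp: indicator_def)
    also have "\<dots> = ennreal (LINT w:ball 0 1|lborel. (cmod (f w))\<^sup>2)"
      using int unfolding set_integrable_def set_lebesgue_integral_def
      by (intro nn_integral_eq_integral) auto
    finally show ?thesis by (simp add: norm)
  qed
  define C where "C = 1 / (1 - \<eta>)\<^sup>2"
  have C0: "C \<ge> 0" by (simp add: C_def)
  have "ennreal (energy p F) = (\<integral>\<^sup>+w\<in>ball 0 1.
     ennreal (cmod (f w) powr p * ((1 - (cmod w)\<^sup>2) / 2) powr (p - 2)) \<partial>lborel)"
    using nn_energy_to_disc[OF bergman_holomorphic[OF F(1)], of p] nn_energy_bergman[OF F(1) p]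
    by (simp add: f_def)
  also have "\<dots> \<le> (\<integral>\<^sup>+w. ennreal (2 powr (2 - p)) *
      (ennreal C * (ennreal (L (1 - (cmod w)\<^sup>2)) * indicator (ball 0 1) w)
       + ennreal Q * (ennreal ((cmod (f w))\<^sup>2) * indicator (ball 0 1) w)) \<partial>lborel)"
  proof (intro nn_integral_mono)
    fix w :: complex
    show "ennreal (cmod (f w) powr p * ((1 - (cmod w)\<^sup>2) / 2) powr (p - 2)) * indicator (ball 0 1) w
      \<le> ennreal (2 powr (2 - p)) *
      (ennreal C * (ennreal (L (1 - (cmod w)\<^sup>2)) * indicator (ball 0 1) w)
       + ennreal Q * (ennreal ((cmod (f w))\<^sup>2) * indicator (ball 0 1) w))"
    proof (cases "w \<in> ball 0 1")
      case True
      have "ennreal (2 powr (2 - p)) * (ennreal C * ennreal (L (1 - (cmod w)\<^sup>2)) + ennreal Q * ennreal ((cmod (f w))\<^sup>2))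
        = ennreal (2 powr (2 - p) * (C * L (1 - (cmod w)\<^sup>2) + Q * (cmod (f w))\<^sup>2))"
        using C0 Q0 by (simp add: ennreal_mult ennreal_plus L_def)
      then show ?thesis using pointwise[OF True] True by (simp add: C_def ennreal_leI)
    qed simp
  qed
  also have "\<dots> = ennreal (2 powr (2 - p)) *
      (ennreal C * (\<integral>\<^sup>+w\<in>ball (0::complex) 1. ennreal (L (1 - (cmod w)\<^sup>2)) \<partial>lborel)
       + ennreal Q * (\<integral>\<^sup>+w\<in>ball 0 1. ennreal ((cmod (f w))\<^sup>2) \<partial>lborel))"
    using meas1 meas2 by (simp add: nn_integral_cmult nn_integral_add)
  also have "\<dots> \<le> ennreal (2 powr (2 - p)) * (ennreal C * ennreal (pi / ((p + 1) * (1 - \<kappa>))) + ennreal Q * ennreal pi)"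
    unfolding I2 by (intro mult_left_mono add_right_mono I1) auto
  also have "\<dots> = ennreal (2 powr (2 - p) * (C * (pi / ((p + 1) * (1 - \<kappa>))) + Q * pi))"
  proof -
    have "ennreal x * (ennreal C * ennreal y + ennreal Q * ennreal pi) = ennreal (x * (C * y + Q * pi))"
      if "x \<ge> 0" "y \<ge> 0" for x y
      using that C0 Q0 by (simp add: ennreal_mult ennreal_plus)
    then show ?thesis using \<kappa> p by simp
  qed
  also have "2 powr (2 - p) * (C * (pi / ((p + 1) * (1 - \<kappa>))) + Q * pi)
     = 2 powr (2 - p) * pi * (1 / ((p + 1) * (1 - \<kappa>) * (1 - \<eta>)\<^sup>2) + Q)"
    by (simp add: C_def distrib_left mult_ac)
  finally show ?thesis
    using \<kappa> \<eta> p Q0 by (subst (asm) ennreal_le_iff) (auto simp: Q_def)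
qed

section \<open>The limit\<close>

lemma concentration_rate:
  "((\<lambda>s::real. 8 * sqrt (1 - (2 * s - 1) powr (- 1 / (s - 1)))) \<longlongrightarrow> 0) at_top"
  by real_asymp

lemma upper_bound_limit:
  fixes \<kappa> :: "real \<Rightarrow> real"
  assumes "(\<kappa> \<longlongrightarrow> 0) at_top"
  shows "((\<lambda>s. (2 * s - 1) * (1 / ((2 * s + 1) * (1 - \<kappa> s) * (1 - 1 / sqrt s)\<^sup>2)
            + exp (- (s - 1) / sqrt s))) \<longlongrightarrow> 1) at_top"
proof -
  have 1: "((\<lambda>s::real. (2 * s - 1) / ((2 * s + 1) * (1 - 1 / sqrt s)\<^sup>2)) \<longlongrightarrow> 1) at_top"
    by real_asymp
  have 2: "((\<lambda>s::real. (2 * s - 1) * exp (- (s - 1) / sqrt s)) \<longlongrightarrow> 0) at_top"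
    by real_asymp
  have "((\<lambda>s. (2 * s - 1) / ((2 * s + 1) * (1 - 1 / sqrt s)\<^sup>2) * (1 / (1 - \<kappa> s))
      + (2 * s - 1) * exp (- (s - 1) / sqrt s)) \<longlongrightarrow> 1 * (1 / (1 - 0)) + 0) at_top"
    by (intro tendsto_intros 1 2 assms) simp
  moreover have "c / (A * B) * (1 / k) + c * E = c * (1 / (A * k * B) + E)" for c A B k E :: real
    by (simp add: distrib_left mult_ac)
  ultimately show ?thesis by (simp only:) simp
qed

text \<open>
  The lower bound for the energy, rewritten as a lower bound for the maximal height \<open>b\<close>.
\<close>

lemma height_bound_of_energy:
  fixes b s :: real
  assumes s: "s > 1" and b: "0 < b"
    and le: "pi * 2 powr (2 - 2 * s) / (2 * s - 1) \<le> b powr (2 * s - 2) * pi"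
  shows "(2 * s - 1) powr (- 1 / (s - 1)) \<le> (2 * b)\<^sup>2"
proof -
  have "pi * (2 powr (2 - 2 * s) / (2 * s - 1)) \<le> pi * b powr (2 * s - 2)"
    using le by (simp only: times_divide_eq_right mult.commute[of _ pi])
  then have "2 powr (2 - 2 * s) / (2 * s - 1) \<le> b powr (2 * s - 2)"
    using pi_gt_zero by (rule mult_left_le_imp_le)
  then have "2 powr (2 * s - 2) * (2 powr (2 - 2 * s) / (2 * s - 1)) \<le> 2 powr (2 * s - 2) * b powr (2 * s - 2)"
    by (rule mult_left_mono) simp
  moreover have "2 powr (2 * s - 2) * 2 powr (2 - 2 * s) = (1::real)"
    by (simp add: powr_add[symmetric])
  ultimately have "1 / (2 * s - 1) \<le> (2 * b) powr (2 * s - 2)"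
    using b by (simp add: powr_mult)
  then have "(2 * s - 1) powr (- 1) \<le> (2 * b) powr (2 * s - 2)"
    using s by (simp add: powr_minus_divide)
  then have "((2 * s - 1) powr (- 1)) powr (1 / (s - 1)) \<le> ((2 * b) powr (2 * s - 2)) powr (1 / (s - 1))"
    using s by (intro powr_mono2) auto
  moreover have "((2 * s - 1) powr (- 1)) powr (1 / (s - 1)) = (2 * s - 1) powr (- 1 / (s - 1))"
    by (simp only: powr_powr) simp
  moreover have "((2 * b) powr (2 * s - 2)) powr (1 / (s - 1)) = (2 * b)\<^sup>2"
  proof -
    have exponent: "(2 * s - 2) * (1 / (s - 1)) = 2" using s by (simp add: field_simps)
    show ?thesis unfolding powr_powr exponent using b by simp
  qed
  ultimately show ?thesis by (simp only:)
qed

lemma LS_quotient_eq: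
  assumes F: "F \<in> bergman_nonzero" and s: "s > 1"
  shows "LS_quotient s F = ennreal (energy (2 * s) F / energy 2 F powr s)"
proof -
  have B: "F \<in> bergman_space" using F by (simp add: bergman_nonzero_def)
  have pos: "energy 2 F > 0" using F energy_two_pos by (auto simp: bergman_nonzero_def)
  have "LS_quotient s F = nn_energy (2 * s) F / ennreal (energy 2 F powr s)"
    by (simp add: LS_quotient_def nn_energy_def energy_two)
  also have "\<dots> = ennreal (energy (2 * s) F / energy 2 F powr s)"
    using s pos by (simp add: nn_energy_bergman[OF B] divide_ennreal energy_nonneg)
  finally show ?thesis .
qed

text \<open>
  The recentred maximizer has at least the energy of the kernel, and at most its maximal height to the
  power \<open>2 s - 2\<close> times its squared norm. This pins the maximal height near its largest possible value, so
  that \<open>energy_le_of_concentrated\<close> applies. The radius \<open>\<eta> = 1 / \<surd>s\<close> tends to \<open>0\<close> while \<open>s \<eta>\<close> tends to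
  infinity faster than \<open>ln s\<close>: the inner part loses nothing in the limit, and the outer part vanishes
  even after multiplication by \<open>2 s - 1\<close>.
\<close>

lemma maximum_upper_bound:
  assumes F: "F \<in> bergman_space" "energy 2 F = 1"
    and opt: "\<And>G. G \<in> bergman_space \<Longrightarrow> energy (2 * s) G \<le> energy (2 * s) F * energy 2 G powr s"
    and s: "s > 1" and \<kappa>_def: "\<kappa> = 8 * sqrt (1 - (2 * s - 1) powr (- 1 / (s - 1)))" and \<kappa>: "\<kappa> \<le> 1 / 2"
  shows "pi powr s * energy (2 * s) F \<le> 2 powr (2 - 2 * s) * pi *
    (1 / ((2 * s + 1) * (1 - \<kappa>) * (1 - 1 / sqrt s)\<^sup>2) + exp (- (s - 1) / sqrt s))"
proof -
  have p: "2 * s \<ge> 2" using s by simp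
  (* sqrt pi is the norm of the constant 1 on the disc. *)
  define F1 where "F1 z = of_real (sqrt pi) * F z" for z
  have F1: "F1 \<in> bergman_space" unfolding F1_def by (rule bergman_scale[OF F(1)])
  have F1_two: "energy 2 F1 = pi" unfolding F1_def energy_scale using F(2) by simp
  have F1_p: "energy (2 * s) F1 = pi powr s * energy (2 * s) F"
    unfolding F1_def energy_scale by (simp add: powr_half_sqrt[symmetric] powr_powr)
  obtain w where w: "Im w > 0"
    "\<And>z. z \<in> upper_half_plane \<Longrightarrow> cmod (F1 z) * Im z \<le> cmod (F1 w) * Im w"
    using half_plane_height_attains_max[OF F1] by blast
  define G where "G = recentre w F1"
  have G: "G \<in> bergman_space" unfolding G_def by (rule recentre_bergman[OF F1 w(1)])
  have G_two: "energy 2 G = pi" unfolding G_def energy_recentre[OF F1 w(1)] by (rule F1_two)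
  have G_p: "energy (2 * s) G = pi powr s * energy (2 * s) F"
    unfolding F1_p[symmetric]
    using nn_energy_recentre[OF bergman_holomorphic[OF F1] w(1), of "2 * s"] G F1 p energy_nonneg
    by (simp add: nn_energy_bergman G_def)
  have "of_real (Re w) + of_real (Im w) * \<i> = w" by (simp add: complex_eq_iff)
  then have Gi: "cmod (G \<i>) = cmod (F1 w) * Im w"
    using recentre_height[OF w(1), of F1 \<i>] by (simp add: G_def)
  have max: "cmod (G z) * Im z \<le> cmod (G \<i>)" if z: "z \<in> upper_half_plane" for z
    unfolding Gi unfolding G_def recentre_height[OF w(1)]
    by (rule w(2)[OF recentre_in_half_plane[OF w(1) z]])
  have kernel_two: "energy 2 bergman_kernel_at_i = pi" by (simp add: energy_kernel)
  have "pi * 2 powr (2 - 2 * s) / (2 * s - 1) \<le> energy (2 * s) F * pi powr s"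
    using opt[OF kernel_bergman] unfolding energy_kernel[OF p] kernel_two .
  also have "\<dots> = energy (2 * s) G" unfolding G_p by (rule mult.commute)
  also have "\<dots> \<le> cmod (G \<i>) powr (2 * s - 2) * pi"
    using energy_le_sup[OF G p max] by (simp add: G_two)
  finally have low': "pi * 2 powr (2 - 2 * s) / (2 * s - 1) \<le> cmod (G \<i>) powr (2 * s - 2) * pi" .
  have "0 < pi * 2 powr (2 - 2 * s) / (2 * s - 1)" using s by simp
  with low' have "cmod (G \<i>) powr (2 * s - 2) * pi > 0" by linarith
  then have Gi0: "G \<i> \<noteq> 0" by auto
  have conc: "(2 * s - 1) powr (- 1 / (s - 1)) \<le> (2 * cmod (G \<i>))\<^sup>2"
    by (rule height_bound_of_energy[OF s _ low']) (use Gi0 in simp)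
  have "(2 * s - 1) powr (- 1 / (s - 1)) < 1"
  proof -
    have "(2 * s - 1) powr (- 1 / (s - 1)) < (2 * s - 1) powr 0"
      using s by (intro powr_less_mono) auto
    then show ?thesis using s by simp
  qed
  then have \<kappa>0: "0 < \<kappa>" by (simp add: \<kappa>_def)
  have \<kappa>1: "8 * sqrt (1 - (2 * cmod (G \<i>))\<^sup>2) \<le> \<kappa>"
    unfolding \<kappa>_def using conc by (intro mult_left_mono real_sqrt_le_mono) auto
  define \<eta> where "\<eta> = 1 / sqrt s"
  have \<eta>: "0 < \<eta>" "\<eta> < 1" using s by (simp_all add: \<eta>_def)
  have "energy (2 * s) G \<le> 2 powr (2 - 2 * s) * pi *
    (1 / ((2 * s + 1) * (1 - \<kappa>) * (1 - \<eta>)\<^sup>2) + (1 - (1 - \<kappa>) * \<eta>) powr (2 * s - 2))"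
    using \<kappa> by (intro energy_le_of_concentrated[OF G G_two Gi0 max \<kappa>0 _ \<kappa>1 \<eta> p]) auto
  also have "\<dots> \<le> 2 powr (2 - 2 * s) * pi *
    (1 / ((2 * s + 1) * (1 - \<kappa>) * (1 - \<eta>)\<^sup>2) + exp (- (s - 1) / sqrt s))"
  proof (intro mult_left_mono add_left_mono)
    have "1 / 2 * \<eta> \<le> (1 - \<kappa>) * \<eta>" using \<kappa> \<eta> by (intro mult_right_mono) auto
    then have "1 - (1 - \<kappa>) * \<eta> \<le> 1 + (- \<eta> / 2)" by simp
    also have "\<dots> \<le> exp (- \<eta> / 2)" by (rule exp_ge_add_one_self)
    finally have le: "1 - (1 - \<kappa>) * \<eta> \<le> exp (- \<eta> / 2)" .
    have "(1 - \<kappa>) * \<eta> \<le> 1 * 1" using \<kappa>0 \<kappa> \<eta> by (intro mult_mono) auto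
    then have "(1 - (1 - \<kappa>) * \<eta>) powr (2 * s - 2) \<le> exp (- \<eta> / 2) powr (2 * s - 2)"
      using s by (intro powr_mono2 le) auto
    also have "\<dots> = exp (- (s - 1) / sqrt s)"
    proof -
      have "(2 * s - 2) * (- (1 / q) / 2) = - (s - 1) / q" for q :: real
        by (cases "q = 0") (simp_all add: field_simps)
      then show ?thesis by (simp only: powr_def exp_not_eq_zero if_False ln_exp \<eta>_def)
    qed
    finally show "(1 - (1 - \<kappa>) * \<eta>) powr (2 * s - 2) \<le> exp (- (s - 1) / sqrt s)" .
  qed simp_all
  finally show ?thesis unfolding G_p \<eta>_def .
qed

theorem proposition1p2:
  "\<exists>M :: real \<Rightarrow> real.
     (\<forall>s>1. is_maximum (LS_quotient s ` bergman_nonzero) (ennreal (M s))) \<and>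
     ((\<lambda>s. M s / (pi powr (1 - s) / ((2 * s - 1) * 2 powr (2 * s - 2)))) \<longlongrightarrow> 1) at_top"
proof -
  have "\<exists>F. s > 1 \<longrightarrow> F \<in> bergman_space \<and> energy 2 F = 1 \<and>
      (\<forall>G\<in>bergman_space. energy (2 * s) G \<le> energy (2 * s) F * energy 2 G powr s)" for s :: real
  proof (cases "s > 1")
    case True
    then have "2 * s > 2" by simp
    then show ?thesis by (rule energy_maximizer) auto
  qed simp
  then obtain F where F: "\<And>s::real. s > 1 \<Longrightarrow> F s \<in> bergman_space"
    "\<And>s::real. s > 1 \<Longrightarrow> energy 2 (F s) = 1"
    "\<And>s G. s > 1 \<Longrightarrow> G \<in> bergman_space \<Longrightarrow> energy (2 * s) G \<le> energy (2 * s) (F s) * energy 2 G powr s"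
    by metis
  define M where "M s = energy (2 * s) (F s)" for s
  define D where "D s = pi powr (1 - s) / ((2 * s - 1) * 2 powr (2 * s - 2))" for s :: real
  have max: "is_maximum (LS_quotient s ` bergman_nonzero) (ennreal (M s))" if s: "s > 1" for s
    unfolding is_maximum_def
  proof (intro conjI ballI)
    have nz: "F s \<in> bergman_nonzero"
    proof (rule ccontr)
      assume "F s \<notin> bergman_nonzero"
      then have "\<forall>z\<in>upper_half_plane. F s z = 0" using F(1)[OF s] by (auto simp: bergman_nonzero_def)
      then have "energy 2 (F s) = 0"
        unfolding energy_def set_lebesgue_integral_def
        by (intro integral_eq_zero_AE AE_I2) (auto simp: indicator_def)
      then show False using F(2)[OF s] by simp
    qed
    have "LS_quotient s (F s) = ennreal (M s)"
      unfolding LS_quotient_eq[OF nz s] by (simp add: F(2)[OF s] M_def)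
    then show "ennreal (M s) \<in> LS_quotient s ` bergman_nonzero" using nz by (metis imageI)
    fix q assume "q \<in> LS_quotient s ` bergman_nonzero"
    then obtain G where G: "G \<in> bergman_nonzero" "q = LS_quotient s G" by blast
    have GB: "G \<in> bergman_space" using G(1) by (simp add: bergman_nonzero_def)
    have pos: "energy 2 G > 0" using G(1) energy_two_pos by (auto simp: bergman_nonzero_def)
    have "energy (2 * s) G / energy 2 G powr s \<le> M s"
      using F(3)[OF s GB] pos by (simp add: M_def divide_le_eq)
    then show "q \<le> ennreal (M s)" unfolding G(2) LS_quotient_eq[OF G(1) s] by (rule ennreal_leI)
  qed
  have ratio: "M s / D s = pi powr s * M s * (2 * s - 1) / (2 powr (2 - 2 * s) * pi)" if s: "s > 1" for s
  proof -
    have "2 powr (2 - 2 * s) * 2 powr (2 * s - 2) = (1::real)" "pi powr (1 - s) * pi powr s = pi"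
      by (simp_all add: powr_add[symmetric])
    then show ?thesis using s unfolding D_def by (simp add: field_simps)
  qed
  define \<kappa> where "\<kappa> s = 8 * sqrt (1 - (2 * s - 1) powr (- 1 / (s - 1)))" for s :: real
  have \<kappa>_lim: "(\<kappa> \<longlongrightarrow> 0) at_top" unfolding \<kappa>_def by (rule concentration_rate)
  have "((\<lambda>s. M s / D s) \<longlongrightarrow> 1) at_top"
  proof (rule tendsto_sandwich[OF _ _ tendsto_const upper_bound_limit[OF \<kappa>_lim]])
    show "\<forall>\<^sub>F s in at_top. 1 \<le> M s / D s"
      using eventually_gt_at_top[of 1]
    proof eventually_elim
      case (elim s)
      have "pi * 2 powr (2 - 2 * s) / (2 * s - 1) \<le> M s * pi powr s"
        using F(3)[OF elim kernel_bergman] elim by (simp add: energy_kernel M_def)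
      then show "1 \<le> M s / D s"
        unfolding ratio[OF elim] using elim by (simp add: field_simps)
    qed
    have "\<forall>\<^sub>F s in at_top. \<kappa> s < 1 / 2" using \<kappa>_lim by (rule order_tendstoD) simp
    with eventually_gt_at_top[of 1]
    show "\<forall>\<^sub>F s in at_top. M s / D s \<le> (2 * s - 1) * (1 / ((2 * s + 1) * (1 - \<kappa> s) * (1 - 1 / sqrt s)\<^sup>2)
            + exp (- (s - 1) / sqrt s))"
    proof eventually_elim
      case (elim s)
      have "pi powr s * M s \<le> 2 powr (2 - 2 * s) * pi *
        (1 / ((2 * s + 1) * (1 - \<kappa> s) * (1 - 1 / sqrt s)\<^sup>2) + exp (- (s - 1) / sqrt s))" (is "_ \<le> _ * _ * ?B")
        unfolding M_def using elim(2)
        by (intro maximum_upper_bound[OF F(1,2,3)]) (use elim in \<open>auto simp: \<kappa>_def\<close>)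
      then have "pi powr s * M s * (2 * s - 1) / (2 powr (2 - 2 * s) * pi)
          \<le> 2 powr (2 - 2 * s) * pi * ?B * (2 * s - 1) / (2 powr (2 - 2 * s) * pi)"
        using elim by (intro divide_right_mono mult_right_mono) auto
      also have "\<dots> = (2 * s - 1) * ?B" by simp
      finally show ?case unfolding ratio[OF elim(1)] .
    qed
  qed
  then show ?thesis using max unfolding D_def by blast
qed

end
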